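(* Let $r\ge 10485731$ be a prime power with $r\equiv 2\pmod{3}$ and $r\equiv \pm 3\pmod{8}$, and let $q=r^2$. Then $G(q)$ is a primitive subgroup of $S_{q-1}$ (the group of all permutations of $\mathbb F_q^*$).
   Context: $\mathbb F_q$ is the field with $q$ elements, $\mathbb F_q^*$ its multiplicative group. $G(q)$ denotes the group of permutations of $\mathbb F_q^*$ generated by all permutations of $\mathbb F_q^*$ which can be represented as $c\mapsto ac^m+bc^n$ with $a,b\in\mathbb F_q^*$ and integers $0<m<n<q$. A group $H$ of permutations of a finite set $X$ is primitive if the only partitions $\mathcal P$ of $X$ such that $h(S)\in\mathcal P$ for all $S\in\mathcal P$ and $h\in H$ are the partition $\{X\}$ and the partition into singletons. *)

theory Defs
  imports Main "HOL-Number_Theory.Prime_Powers" "HOL-Library.Disjoint_Sets"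
begin

definition units_set :: "'a::{finite,field} set" where
  "units_set = UNIV - {0}"

text \<open>Generators: maps c |-> a c^m + b c^n (a, b nonzero, 0 < m < n < q) that permute
  the nonzero elements. (They automatically fix 0 since m, n > 0.)\<close>
definition binom_gens :: "('a::{finite,field} \<Rightarrow> 'a) set" where
  "binom_gens = {f. \<exists>a b (m::nat) (n::nat). a \<noteq> 0 \<and> b \<noteq> 0 \<and> 0 < m \<and> m < n \<and> n < card (UNIV :: 'a set)
      \<and> f = (\<lambda>c. a * c ^ m + b * c ^ n) \<and> bij_betw f units_set units_set}"

inductive_set G_q :: "('a::{finite,field} \<Rightarrow> 'a) set" where
  G_id: "id \<in> G_q"
| G_gen: "f \<in> binom_gens \<Longrightarrow> f \<in> G_q"
| G_comp: "f \<in> G_q \<Longrightarrow> g \<in> G_q \<Longrightarrow> f \<circ> g \<in> G_q"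
| G_inv: "f \<in> G_q \<Longrightarrow> inv f \<in> G_q"

definition primitive_on :: "'b set \<Rightarrow> ('b \<Rightarrow> 'b) set \<Rightarrow> bool" where
  "primitive_on X H \<longleftrightarrow>
     (\<forall>P. partition_on X P \<and> (\<forall>h\<in>H. \<forall>S\<in>P. h ` S \<in> P) \<longrightarrow>
          P = {X} \<or> P = {{x} | x. x \<in> X})"

end

theory Submission
  imports Defs Complex_Main "HOL-Computational_Algebra.Polynomial" "HOL-Number_Theory.Cong"
    "HOL-Library.FuncSet"
begin

text \<open>
  Every invertible linear map of the plane \<open>F\<close> over its subfield \<open>K\<close> of order \<open>r\<close> has the form
  \<open>c \<mapsto> a c + b c\<^sup>r\<close>. Hence all of them lie in \<open>G(q)\<close>, and the block of \<open>1\<close> in an invariant partition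
  is either everything or a subgroup of the units of \<open>K\<close>. In the second case the binomial
  \<open>c\<^bsup>r+2\<^esup> + (1 - w) c\<close> with \<open>w\<close> a primitive cube root of unity forces the block into \<open>{1, -1}\<close>.
  A permutation binomial \<open>a c + c\<^bsup>g+1\<^esup>\<close> with \<open>g = (q - 1) / 8\<close> odd separates \<open>1\<close> from \<open>-1\<close>.
  Such a binomial permutes as soon as the values \<open>(a + \<zeta>\<^sup>j)\<^sup>g\<close> at the eighth roots of unity \<open>\<zeta>\<^sup>j\<close>
  satisfy seven multiplicative conditions, which cut out a subgroup of index \<open>2\<^bsup>17\<^esup>\<close>; a suitable \<open>a\<close> exists
  because the relevant octic character sums are at most \<open>50 r + 9\<close> in absolute value. That bound
  follows from Bombieri's variant of the Stepanov method, which is elementary here as \<open>q = r\<^sup>2\<close>.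
\<close>

section \<open>The Stepanov method over a field of square order\<close>

lemma finite_field_power_card:
  fixes x :: "'a::{finite,field}"
  shows "x ^ card (UNIV :: 'a set) = x"
proof (cases "x = 0")
  case False
  let ?n = "card (UNIV :: 'a set)"
  have pos: "?n > 0" by (simp add: card_gt_0_iff)
  have "(\<Prod>y\<in>UNIV-{0}. y) = (\<Prod>y\<in>UNIV-{0}. x * y)"
    by (rule prod.reindex_bij_witness[of _ "\<lambda>y. x * y" "\<lambda>y. y / x"]) (use False in auto)
  also have "\<dots> = x ^ (?n - 1) * (\<Prod>y\<in>UNIV-{0}. y)"
    by (simp add: prod.distrib)
  finally have "x ^ (?n - 1) = 1" by simp
  hence "x ^ Suc (?n - 1) = x" by simp
  thus ?thesis using pos by simp
qed (simp add: card_gt_0_iff)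

text \<open>There are more unknowns than equations: two coefficient families give the same
  \<open>M\<close> coefficients by the pigeonhole principle, and their difference is the relation.
  Counting replaces dimension theory.\<close>

lemma nontrivial_poly_relation:
  fixes U :: "'i \<Rightarrow> 'a::{finite,field} poly"
  assumes "finite I" "\<And>i. i \<in> I \<Longrightarrow> degree (U i) < M" "M < card I"
  shows "\<exists>B. (\<exists>i\<in>I. B i \<noteq> 0) \<and> (\<Sum>i\<in>I. smult (B i) (U i)) = 0"
proof -
  define \<Phi> where "\<Phi> B = (\<lambda>j\<in>{..<M}. coeff (\<Sum>i\<in>I. smult (B i) (U i)) j)" for B
  let ?q = "card (UNIV :: 'a set)"
  have "card {0, 1 :: 'a} \<le> ?q" by (intro card_mono) auto
  hence q: "1 < ?q" by simp
  have "card (PiE {..<M} (\<lambda>_. UNIV :: 'a set)) < card (PiE I (\<lambda>_. UNIV :: 'a set))"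
    using q assms by (simp add: card_PiE)
  moreover have "\<Phi> ` (PiE I (\<lambda>_. UNIV)) \<subseteq> PiE {..<M} (\<lambda>_. UNIV)"
    by (auto simp: \<Phi>_def split: if_splits)
  ultimately have "\<not> inj_on \<Phi> (PiE I (\<lambda>_. UNIV))"
    by (metis card_inj_on_le finite_PiE finite_lessThan finite leD)
  then obtain B C where BC: "B \<in> PiE I (\<lambda>_. UNIV)" "C \<in> PiE I (\<lambda>_. UNIV)" "B \<noteq> C" "\<Phi> B = \<Phi> C"
    by (auto simp: inj_on_def)
  let ?S = "\<lambda>B. \<Sum>i\<in>I. smult (B i) (U i)"
  have high: "coeff (?S B) j = 0" if "j \<ge> M" for j B
    using less_le_trans[OF assms(2) that] by (simp add: coeff_sum coeff_eq_0)
  have "coeff (?S B) j = coeff (?S C) j" for j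
  proof (cases "j < M")
    case True
    thus ?thesis using fun_cong[OF BC(4), of j] by (simp add: \<Phi>_def)
  qed (simp add: high)
  hence "?S B = ?S C" by (simp add: poly_eq_iff)
  hence "?S (\<lambda>i. B i - C i) = 0" by (simp add: smult_diff_left sum_subtractf)
  moreover have "\<exists>i\<in>I. B i - C i \<noteq> 0"
  proof (rule ccontr)
    assume "\<not> (\<exists>i\<in>I. B i - C i \<noteq> 0)"
    hence "B i = C i" if "i \<in> I" for i using that by simp
    hence "B = C" by (rule PiE_ext[OF BC(1,2)])
    with BC(3) show False by contradiction
  qed
  ultimately show ?thesis by (intro exI[of _ "\<lambda>i. B i - C i"] conjI)
qed

text \<open>Among the terms with \<open>A i \<noteq> 0\<close> exactly one has the largest degree,
  and its leading coefficient cannot cancel.\<close>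

lemma sum_distinct_degrees_neq_0:
  fixes b :: "'i \<Rightarrow> 'a::field poly"
  assumes "finite I" "inj_on (\<lambda>i. degree (b i)) I" "\<And>i. i \<in> I \<Longrightarrow> b i \<noteq> 0"
    and "i0 \<in> I" "A i0 \<noteq> 0"
  shows "(\<Sum>i\<in>I. smult (A i) (b i)) \<noteq> 0"
proof -
  define K where "K = {i\<in>I. A i \<noteq> 0}"
  have K: "finite K" "K \<noteq> {}" using assms by (auto simp: K_def)
  obtain k where k: "k \<in> K" "\<And>i. i \<in> K \<Longrightarrow> degree (b i) \<le> degree (b k)"
    using Max_in[of "(\<lambda>i. degree (b i)) ` K"] Max_ge[of "(\<lambda>i. degree (b i)) ` K"] K
    by (smt (verit) finite_imageI image_iff image_is_empty)
  have z: "coeff (smult (A i) (b i)) (degree (b k)) = 0" if "i \<in> I" "i \<noteq> k" for i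
  proof (cases "i \<in> K")
    case True
    hence "degree (b i) \<noteq> degree (b k)"
      using assms(2) k(1) that by (auto simp: inj_on_def K_def)
    with k(2)[OF True] show ?thesis by (simp add: coeff_eq_0)
  qed (use that in \<open>simp add: K_def\<close>)
  have "k \<in> I" using k by (simp add: K_def)
  have "coeff (\<Sum>i\<in>I. smult (A i) (b i)) (degree (b k))
      = (\<Sum>i\<in>I. coeff (smult (A i) (b i)) (degree (b k)))"
    by (simp add: coeff_sum)
  also have "\<dots> = (\<Sum>i\<in>{k}. coeff (smult (A i) (b i)) (degree (b k)))"
    using assms(1) \<open>k \<in> I\<close> z by (intro sum.mono_neutral_right) auto
  also have "\<dots> = A k * lead_coeff (b k)" by simp
  finally show ?thesis using k(1) assms(3) by (auto simp: K_def)
qed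

text \<open>Pair \<open>k\<close> with \<open>d - k\<close>: the two residues add up to
  \<open>0\<close> or \<open>d\<close>. An average residue of at most \<open>(d - 1) / 2\<close>
  later halves the loss in the count of auxiliary polynomials.\<close>

lemma sum_mult_mod_le:
  fixes d e :: nat
  assumes "d > 0"
  shows "2 * (\<Sum>k<d. (k * e) mod d) \<le> d * (d - 1)"
proof -
  let ?f = "\<lambda>k. (k * e) mod d"
  have eq: "(\<Sum>k<d. ?f k) = (\<Sum>k\<in>{1..<d}. ?f k)"
    by (rule sum.mono_neutral_right) (auto simp: not_le)
  have "(\<Sum>k\<in>{1..<d}. ?f k) = (\<Sum>k\<in>{1..<d}. ?f (d - k))"
    by (rule sum.reindex_bij_witness[of _ "\<lambda>k. d - k" "\<lambda>k. d - k"]) auto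
  hence "2 * (\<Sum>k<d. ?f k) = (\<Sum>k\<in>{1..<d}. ?f k + ?f (d - k))"
    by (simp add: eq sum.distrib)
  also have "\<dots> \<le> (\<Sum>k\<in>{1..<d}. d)"
  proof (rule sum_mono)
    fix k assume k: "k \<in> {1..<d}"
    have "(?f k + ?f (d - k)) mod d = (k * e + (d - k) * e) mod d" by (simp add: mod_add_eq)
    also have "k * e + (d - k) * e = d * e" using k by (simp flip: add_mult_distrib)
    finally have "d dvd ?f k + ?f (d - k)" by (simp add: mod_eq_0_iff_dvd)
    then obtain t where t: "?f k + ?f (d - k) = d * t" by (auto elim: dvdE)
    have "?f k + ?f (d - k) < d + d" using assms by (intro add_strict_mono) auto
    hence "t < 2" unfolding t using assms by (metis mult_2_right nat_mult_less_cancel_disj)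
    thus "?f k + ?f (d - k) \<le> d" unfolding t by simp
  qed
  finally show ?thesis by (simp add: mult.commute)
qed

lemma card_multiples_less:
  fixes d s :: nat
  assumes "d > 0"
  shows "finite {a. d * a < s}" "s \<le> d * card {a. d * a < s}"
proof -
  have "a \<le> s" if "d * a < s" for a
    using that assms by (metis One_nat_def Suc_leI le_trans less_imp_le mult_le_mono1 nat_mult_1)
  hence "{a. d * a < s} \<subseteq> {..s}" by auto
  thus fin: "finite {a. d * a < s}" by (rule finite_subset) simp
  define t where "t = (s + (d - 1)) div d"
  have "{..<t} \<subseteq> {a. d * a < s}"
  proof
    fix a assume "a \<in> {..<t}"
    hence "Suc a \<le> (s + (d - 1)) div d" by (simp add: t_def)
    hence "Suc a * d \<le> s + (d - 1)" using assms by (simp only: less_eq_div_iff_mult_less_eq)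
    hence "d * a + d \<le> s + (d - 1)" by (simp add: mult.commute)
    hence "d * a < s" using assms by linarith
    thus "a \<in> {a. d * a < s}" by blast
  qed
  hence "t \<le> card {a. d * a < s}" using card_mono[OF fin, of "{..<t}"] by (simp only: card_lessThan)
  moreover have "s \<le> d * t"
  proof -
    have "s + (d - 1) < d * t + d"
      unfolding t_def using dividend_less_times_div[OF assms, of "s + (d - 1)"] by simp
    thus ?thesis using assms by linarith
  qed
  ultimately show "s \<le> d * card {a. d * a < s}"
    using mult_le_mono2 order_trans by blast
qed

section \<open>Fields of square order and their Frobenius map\<close>

locale quadratic_field =
  fixes r :: nat and ty :: "'a::{finite,field} itself"
  assumes primepow_r: "primepow r"
    and card_field: "card (UNIV :: 'a set) = r ^ 2"
begin

lemma power_r_r: "(x::'a) ^ (r * r) = x"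
  using finite_field_power_card[of x] by (simp add: card_field power2_eq_square)

lemma r_gt_1: "r > 1"
  using primepow_r primepow_gt_Suc_0 by auto

lemma power_q_minus_1: "(x::'a) \<noteq> 0 \<Longrightarrow> x ^ (r\<^sup>2 - 1) = 1"
proof -
  assume "x \<noteq> 0"
  have "Suc (r\<^sup>2 - 1) = r * r" using r_gt_1 by (simp add: power2_eq_square)
  hence "x * x ^ (r\<^sup>2 - 1) = x" using power_r_r[of x] by (metis power_Suc)
  thus ?thesis using \<open>x \<noteq> 0\<close> by simp
qed

text \<open>Translation by \<open>1\<close> permutes the field, so the sum of all ones vanishes and
  the characteristic divides \<open>r\<^sup>2\<close>. This makes the \<open>r\<close>-th power
  additive.\<close>

lemma r_eq_CHAR_power: "prime CHAR('a)" "\<exists>k. r = CHAR('a) ^ k"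
proof -
  show p: "prime CHAR('a)"
    by (intro prime_CHAR_semidom finite_imp_CHAR_pos) simp
  obtain p k where pk: "prime p" "r = p ^ k"
    using primepow_r by (auto simp: primepow_def)
  have "(\<Sum>x\<in>UNIV. x :: 'a) = (\<Sum>x\<in>UNIV. x + 1)"
    by (rule sum.reindex_bij_witness[of _ "\<lambda>x. x + 1" "\<lambda>x. x - 1"]) auto
  hence "of_nat (r ^ 2) = (0 :: 'a)" by (simp add: sum.distrib card_field flip: of_nat_power)
  hence "CHAR('a) dvd r ^ 2" using of_nat_eq_0_iff_char_dvd by blast
  hence "CHAR('a) dvd p" using p pk prime_dvd_power by blast
  hence "CHAR('a) = p" using p pk by (simp add: primes_dvd_imp_eq)
  thus "\<exists>k. r = CHAR('a) ^ k" using pk by blast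
qed

lemma frobenius_sum: "(\<Sum>i\<in>I. f i :: 'a) ^ r = (\<Sum>i\<in>I. f i ^ r)"
  using r_eq_CHAR_power freshmans_dream_sum' by blast

lemma frobenius_add: "(x + y :: 'a) ^ r = x ^ r + y ^ r"
  using r_eq_CHAR_power freshmans_dream' by blast

text \<open>
  Bombieri's form of the Stepanov method: if \<open>\<Sum> B\<^sub>i U\<^sub>i = 0\<close>, then \<open>V = \<Sum> B\<^sub>i\<^sup>r b\<^sub>i\<close> satisfies
  \<open>V\<^sup>r = \<Sum> B\<^sub>i U\<^sub>i = 0\<close> on \<open>T\<close>, because \<open>B\<^sub>i\<close> is fixed by the \<open>r\<^sup>2\<close>-power map.
\<close>
lemma card_le_of_frobenius_relation:
  fixes b U :: "'i \<Rightarrow> 'a poly"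
  assumes I: "finite I" "inj_on (\<lambda>i. degree (b i)) I"
    and b: "\<And>i. i \<in> I \<Longrightarrow> b i \<noteq> 0" "\<And>i. i \<in> I \<Longrightarrow> degree (b i) \<le> N"
    and U: "\<And>i. i \<in> I \<Longrightarrow> degree (U i) < M" "M < card I"
    and T: "\<And>i x. i \<in> I \<Longrightarrow> x \<in> T \<Longrightarrow> poly (b i) x ^ r = poly (U i) x"
  shows "card T \<le> N"
proof -
  obtain B i0 where B: "i0 \<in> I" "B i0 \<noteq> 0" "(\<Sum>i\<in>I. smult (B i) (U i)) = 0"
    using nontrivial_poly_relation[OF I(1), of U M] U by blast
  define V where "V = (\<Sum>i\<in>I. smult (B i ^ r) (b i))"
  have "V \<noteq> 0"
    unfolding V_def using I b B by (intro sum_distinct_degrees_neq_0[of _ _ i0]) auto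
  have "poly V x = 0" if "x \<in> T" for x
  proof -
    have "poly V x ^ r = (\<Sum>i\<in>I. (B i ^ r * poly (b i) x) ^ r)"
      by (simp add: V_def poly_sum frobenius_sum)
    also have "\<dots> = (\<Sum>i\<in>I. B i * poly (U i) x)"
      using T that by (intro sum.cong) (auto simp: power_mult_distrib power_r_r simp flip: power_mult)
    also have "\<dots> = poly (\<Sum>i\<in>I. smult (B i) (U i)) x" by (simp add: poly_sum)
    finally show ?thesis using B(3) by simp
  qed
  hence "card T \<le> card {x. poly V x = 0}"
    by (intro card_mono) auto
  also have "\<dots> \<le> degree V" by (rule card_poly_roots_bound) fact
  also have "\<dots> \<le> N"
    unfolding V_def using b(2) by (intro degree_sum_le I) (auto intro: order_trans[OF degree_smult_le])
  finally show ?thesis .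
qed

text \<open>On the residue class the \<open>r\<close>-th power of the auxiliary polynomial
  \<open>b (k, a, i)\<close> agrees with \<open>U (k, a, i)\<close>, where the small and the large
  exponents have changed roles. So both families have degree at most about
  \<open>r\<^sup>2 / d\<close>, and there are enough indices to force a relation among the
  \<open>U\<close>. Coprimality keeps the degrees of the \<open>b\<close> distinct.\<close>

lemma card_power_residue_class_le:
  fixes \<beta> :: "'b \<Rightarrow> 'a" and e :: "'b \<Rightarrow> nat"
  assumes J: "finite J"
    and d: "d > 1" "d dvd r\<^sup>2 - 1"
    and cop: "coprime (\<Sum>j\<in>J. e j) d"
    and c: "c = card J * (d - 1)" "c\<^sup>2 + 3 * c + 2 * d < 2 * r"
    and "\<epsilon> \<noteq> 0"
  shows "d * card {x. (\<Prod>j\<in>J. (x - \<beta> j) ^ e j) ^ ((r\<^sup>2 - 1) div d) = \<epsilon>} \<le> r\<^sup>2 + (c + 1) * r"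
proof -
  define g where "g = (r\<^sup>2 - 1) div d"
  have gd: "g * d = r\<^sup>2 - 1" unfolding g_def using d by simp
  have r1: "r\<^sup>2 \<ge> 1" using r_gt_1 by simp
  define T where "T = {x. (\<Prod>j\<in>J. (x - \<beta> j) ^ e j) ^ g = \<epsilon>}"
  \<comment> \<open>\<open>k' k\<close> is \<open>- r * k\<close> modulo \<open>d\<close>, so the
    numerators of \<open>G\<close> and \<open>H\<close> are divisible by \<open>d\<close>. As
    \<open>r * r\<close> is \<open>1\<close> modulo \<open>d\<close>, it is an involution.\<close>
  define k' where "k' k = (r * (d - 1) * k) mod d" for k
  define P where "P k j = (k * e j) mod d" for k j
  define D where "D k = (\<Sum>j\<in>J. P k j)" for k
  define G where "G k j = (P (k' k) j + r * P k j) div d" for k j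
  define H where "H k j = (r * P (k' k) j + P k j) div d" for k j
  \<comment> \<open>The excess \<open>c\<close> over \<open>r\<close> pays for the average loss of
    \<open>c / 2\<close> in each of the two factors of the index count.\<close>
  define m where "m = r + c"
  have rr: "[r * r = 1] (mod d)"
    using d(2) r1 by (simp add: cong_altdef_nat power2_eq_square)
  have dd: "[(d - 1) * (d - 1) = 1] (mod d)"
  proof -
    have "(d - 1) * (d - 1) = (d - 2) * d + 1"
    proof -
      obtain t where "d = t + 2" using d(1) by (metis Suc_1 Suc_leI le_add_diff_inverse2)
      thus ?thesis by (simp add: algebra_simps)
    qed
    thus ?thesis by (simp only: cong_def mod_mult_self3)
  qed
  have P_dvd: "d dvd P (k' k) j + r * P k j" for k j
  proof -
    have "[P (k' k) j + r * P k j = (r * (d - 1) * k) * e j + r * (k * e j)] (mod d)"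
      unfolding P_def k'_def by (intro cong_add cong_mult) (simp_all add: cong_def mod_mult_left_eq)
    also have "(r * (d - 1) * k) * e j + r * (k * e j) = d * (r * k * e j)"
      using d(1) by (cases d) (simp_all add: algebra_simps)
    finally show ?thesis by (simp add: cong_def mod_eq_0_iff_dvd)
  qed
  have dG: "d * G k j = P (k' k) j + r * P k j" for k j
    using P_dvd[of k j] by (simp add: G_def)
  have dH: "d * H k j = r * P (k' k) j + P k j" for k j
  proof -
    have "[r * P (k' k) j + P k j = r * P (k' k) j + (r * r) * P k j] (mod d)"
      using rr by (intro cong_add cong_refl) (metis cong_scalar_right cong_sym mult_1)
    also have "r * P (k' k) j + (r * r) * P k j = r * (P (k' k) j + r * P k j)"
      by (simp add: algebra_simps)
    also have "[\<dots> = 0] (mod d)" using P_dvd[of k j] by (simp add: cong_0_iff)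
    finally show ?thesis by (simp add: H_def cong_0_iff)
  qed
  have P_less: "P k j \<le> d - 1" for k j
    using d(1) unfolding P_def by (metis Suc_pred' less_Suc_eq_le mod_less_divisor order_less_trans zero_less_one)
  have D_le: "D k \<le> c" for k
    unfolding D_def c(1) by (rule order_trans[OF sum_bounded_above[of J _ "d - 1"]]) (use P_less in auto)
  have c_lt: "c < r" using c(2) by simp
  have k'_lt: "k' k < d" for k using d(1) by (simp add: k'_def)
  have k'_k': "k' (k' k) = k" if "k < d" for k
  proof -
    have "[k' (k' k) = (r * (d - 1)) * (r * (d - 1) * k)] (mod d)"
      unfolding k'_def by (simp add: cong_def mod_mult_right_eq)
    also have "(r * (d - 1)) * (r * (d - 1) * k) = ((r * r) * ((d - 1) * (d - 1))) * k"
      by (simp add: algebra_simps)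
    also have "[\<dots> = (1 * 1) * k] (mod d)" by (intro cong_mult rr dd cong_refl)
    finally show ?thesis using that k'_lt by (simp add: cong_less_modulus_unique_nat)
  qed
  have sum_D: "2 * (\<Sum>k<d. D k) \<le> d * c"
  proof -
    have "2 * (\<Sum>k<d. D k) = (\<Sum>j\<in>J. 2 * (\<Sum>k<d. P k j))"
      unfolding D_def by (subst sum.swap) (simp add: sum_distrib_left)
    also have "\<dots> \<le> (\<Sum>j\<in>J. d * (d - 1))"
      unfolding P_def using d(1) by (intro sum_mono sum_mult_mod_le) auto
    finally show ?thesis by (simp add: c(1) mult_ac)
  qed
  have sum_D': "(\<Sum>k<d. D (k' k)) = (\<Sum>k<d. D k)"
    by (rule sum.reindex_bij_witness[of _ k' k']) (auto simp: k'_lt k'_k')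

  \<comment> \<open>The bounds make \<open>d * i + D (k' k)\<close> the remainder and
    \<open>d * a + D k\<close> the quotient of \<open>d * degree (b (k, a, i))\<close> by
    \<open>r\<close>. For \<open>U\<close> the weights \<open>1\<close> and \<open>r\<close> are
    exchanged.\<close>
  define I where "I = Sigma {..<d} (\<lambda>k. {a. d * a < m + 1 - D k} \<times> {i. d * i < r - D (k' k)})"
  define b where "b = (\<lambda>(k, a, i). monom 1 (i + r * a) * (\<Prod>j\<in>J. [:- \<beta> j, 1:] ^ G k j))"
  define U where "U = (\<lambda>(k, a, i). smult (\<epsilon> ^ k) (monom 1 (r * i + a) * (\<Prod>j\<in>J. [:- \<beta> j, 1:] ^ H k j)))"
  have deg_prod: "degree (\<Prod>j\<in>J. [:- \<beta> j, 1:] ^ F j) = (\<Sum>j\<in>J. F j)" for F :: "'b \<Rightarrow> nat"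
    by (subst degree_prod_eq_sum_degree) (simp_all add: degree_power_eq)
  have prod_nz: "(\<Prod>j\<in>J. [:- \<beta> j, 1:] ^ F j) \<noteq> 0" for F :: "'b \<Rightarrow> nat"
    using J by simp
  have b_nz: "b t \<noteq> 0" for t
    using prod_nz by (auto simp: b_def split: prod.splits)
  have deg_b: "d * degree (b (k, a, i)) = (d * i + D (k' k)) + r * (d * a + D k)" for k a i
  proof -
    have "degree (b (k, a, i)) = i + r * a + (\<Sum>j\<in>J. G k j)"
      using prod_nz by (simp add: b_def degree_mult_eq deg_prod degree_monom_eq)
    hence "d * degree (b (k, a, i)) = d * i + r * (d * a) + (\<Sum>j\<in>J. d * G k j)"
      by (simp add: algebra_simps sum_distrib_left)
    thus ?thesis by (simp add: dG D_def sum.distrib sum_distrib_left algebra_simps)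
  qed
  have deg_U: "d * degree (U (k, a, i)) = r * (d * i + D (k' k)) + (d * a + D k)" for k a i
  proof -
    have "degree (U (k, a, i)) = r * i + a + (\<Sum>j\<in>J. H k j)"
      using prod_nz \<open>\<epsilon> \<noteq> 0\<close> by (simp add: U_def degree_mult_eq deg_prod degree_monom_eq)
    hence "d * degree (U (k, a, i)) = r * (d * i) + d * a + (\<Sum>j\<in>J. d * H k j)"
      by (simp add: algebra_simps sum_distrib_left)
    thus ?thesis by (simp add: dH D_def sum.distrib sum_distrib_left algebra_simps)
  qed
  have I_D: "k < d \<and> d * a + D k \<le> m \<and> d * i + D (k' k) < r" if "(k, a, i) \<in> I" for k a i
    using that by (auto simp: I_def)
  have fin: "finite I"
    unfolding I_def using d(1) by (auto intro!: finite_SigmaI card_multiples_less)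
  have inj: "inj_on (\<lambda>t. degree (b t)) I"
  proof (rule inj_onI)
    fix s t assume st: "s \<in> I" "t \<in> I" "degree (b s) = degree (b t)"
    obtain k a i l a2 i2 where s: "s = (k, a, i)" and t: "t = (l, a2, i2)"
      by (metis prod.collapse)
    note * = st[unfolded s t]
    let ?p = "d * i + D (k' k)" and ?p2 = "d * i2 + D (k' l)"
    have "?p + r * (d * a + D k) = ?p2 + r * (d * a2 + D l)"
      using *(3) deg_b by metis
    hence "(?p + r * (d * a + D k)) mod r = (?p2 + r * (d * a2 + D l)) mod r"
      "(?p + r * (d * a + D k)) div r = (?p2 + r * (d * a2 + D l)) div r" by simp_all
    moreover have "?p < r" "?p2 < r" using I_D[OF *(1)] I_D[OF *(2)] by simp_all
    ultimately have eq: "?p = ?p2" "d * a + D k = d * a2 + D l"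
      using r_gt_1 by simp_all
    \<comment> \<open>Modulo \<open>d\<close> the quotient reveals \<open>k\<close>, because the
      total exponent is coprime to \<open>d\<close>.\<close>
    have D_cong: "[D k = k * (\<Sum>j\<in>J. e j)] (mod d)" for k
      unfolding D_def P_def sum_distrib_left by (intro cong_sum) (simp add: cong_def)
    have "[D k = D l] (mod d)"
      using arg_cong[OF eq(2), of "\<lambda>x. x mod d"] by (simp add: cong_def)
    hence "[k * (\<Sum>j\<in>J. e j) = l * (\<Sum>j\<in>J. e j)] (mod d)"
      using D_cong by (meson cong_sym cong_trans)
    hence "[k = l] (mod d)" using cop by (simp add: cong_mult_rcancel_nat)
    hence "k = l" using I_D[OF *(1)] I_D[OF *(2)] by (simp add: cong_less_modulus_unique_nat)
    with eq d(1) show "s = t" by (simp add: s t)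
  qed
  define N where "N = (r - 1 + r * m) div d"
  define M where "M = (r * (r - 1) + m) div d + 1"
  have deg_b_le: "degree (b t) \<le> N" if "t \<in> I" for t
  proof -
    obtain k a i where t: "t = (k, a, i)" by (metis prod.collapse)
    have "d * degree (b t) \<le> (r - 1) + r * m"
      unfolding t deg_b using I_D that t by (intro add_mono mult_left_mono) fastforce+
    thus ?thesis unfolding N_def using d(1) by (simp add: less_eq_div_iff_mult_less_eq mult.commute)
  qed
  have deg_U_less: "degree (U t) < M" if "t \<in> I" for t
  proof -
    obtain k a i where t: "t = (k, a, i)" by (metis prod.collapse)
    have "d * degree (U t) \<le> r * (r - 1) + m"
      unfolding t deg_U using I_D that t by (intro add_mono mult_left_mono) fastforce+
    hence "degree (U t) \<le> (r * (r - 1) + m) div d"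
      using d(1) by (simp add: less_eq_div_iff_mult_less_eq mult.commute)
    thus ?thesis by (simp add: M_def)
  qed
  have M_less: "M < card I"
  proof -
    define A where "A k = card {a. d * a < m + 1 - D k}" for k
    define B where "B k = card {i. d * i < r - D (k' k)}" for k
    have cI: "card I = (\<Sum>k<d. A k * B k)"
      unfolding I_def A_def B_def using d(1)
      by (subst card_SigmaI) (auto simp: card_cartesian_product intro!: card_multiples_less)
    \<comment> \<open>Dropping the nonnegative product \<open>D k * D (k' k)\<close> leaves a bound
      linear in \<open>D\<close>, to which the average applies.\<close>
    have "int (m + 1) * int r - int (m + 1) * int (D (k' k)) - int r * int (D k)
        \<le> int d * int d * (int (A k) * int (B k))" for k
    proof -
      have le: "D k \<le> m + 1" "D (k' k) \<le> r"
        using D_le[of k] D_le[of "k' k"] c_lt by (auto simp: m_def)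
      have "int (m + 1) * int r - int (m + 1) * int (D (k' k)) - int r * int (D k)
          \<le> (int (m + 1) - int (D k)) * (int r - int (D (k' k)))"
        by (simp add: algebra_simps)
      also have "\<dots> = int ((m + 1 - D k) * (r - D (k' k)))" using le by (simp add: of_nat_diff)
      also have "(m + 1 - D k) * (r - D (k' k)) \<le> (d * A k) * (d * B k)"
        unfolding A_def B_def using d(1) by (intro mult_mono card_multiples_less) auto
      finally show ?thesis by (simp add: mult_ac)
    qed
    hence "(\<Sum>k<d. int (m + 1) * int r - int (m + 1) * int (D (k' k)) - int r * int (D k))
        \<le> (\<Sum>k<d. int d * int d * (int (A k) * int (B k)))"
      by (intro sum_mono)
    hence "int d * (int (m + 1) * int r) - int (m + 1) * int (\<Sum>k<d. D (k' k)) - int r * int (\<Sum>k<d. D k)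
        \<le> int d * int d * int (card I)"
      by (simp add: sum_subtractf cI sum_distrib_left)
    hence "int d * (2 * (int (m + 1) * int r)) - (int (m + 1) + int r) * (2 * int (\<Sum>k<d. D k))
        \<le> int d * (2 * (int d * int (card I)))"
      unfolding sum_D' by (simp add: algebra_simps)
    moreover have "(int (m + 1) + int r) * (2 * int (\<Sum>k<d. D k)) \<le> (int (m + 1) + int r) * (int d * int c)"
      using sum_D by (intro mult_left_mono) (simp_all flip: of_nat_mult of_nat_sum)
    ultimately have "int d * (2 * (int (m + 1) * int r) - (int (m + 1) + int r) * int c)
        \<le> int d * (2 * (int d * int (card I)))"
      by (simp add: algebra_simps)
    hence 1: "2 * (int (m + 1) * int r) - (int (m + 1) + int r) * int c \<le> 2 * (int d * int (card I))"
      using d(1) by simp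
    have "d * M \<le> r * (r - 1) + m + d" by (simp add: M_def)
    hence "int (d * M) \<le> int (r * (r - 1) + m + d)" by (simp only: of_nat_le_iff)
    hence "int d * int M \<le> int r * (int r - 1) + int m + int d"
      using r_gt_1 by (simp add: of_nat_diff)
    moreover have "int (c\<^sup>2 + 3 * c + 2 * d) < int (2 * r)" using c(2) by (simp only: of_nat_less_iff)
    \<comment> \<open>With \<open>m = r + c\<close> the terms in \<open>c * r\<close> cancel, and
      exactly \<open>c\<^sup>2 + 3 * c + 2 * d < 2 * r\<close> remains.\<close>
    ultimately have "2 * (int d * int M) < 2 * (int d * int (card I))"
      using 1 by (simp add: m_def algebra_simps power2_eq_square)
    thus ?thesis using d(1) by simp
  qed
  have "card T \<le> N"
  proof (rule card_le_of_frobenius_relation[of I b N U M T])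
    fix t x assume t: "t \<in> I" and x: "x \<in> T"
    obtain k a i where t': "t = (k, a, i)" by (metis prod.collapse)
    have eps: "\<epsilon> = (\<Prod>j\<in>J. ((x - \<beta> j) ^ e j) ^ g)"
      using x by (simp add: T_def prod_power_distrib)
    have factor: "((x - \<beta> j) ^ G k j) ^ r = (((x - \<beta> j) ^ e j) ^ g) ^ k * (x - \<beta> j) ^ H k j"
      if "j \<in> J" for j
    \<comment> \<open>Here \<open>x - \<beta> j\<close> may vanish even on \<open>T\<close>, but the
      factor is absent from both sides.\<close>
    proof (cases "e j = 0")
      case True
      hence "G k j = 0" "H k j = 0" by (simp_all add: G_def H_def P_def)
      with True show ?thesis by simp
    next
      case False
      have "r\<^sup>2 > 1" using r_gt_1 by (intro one_less_power) auto
      hence g: "g > 0" using gd by (cases "g = 0") auto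
      have nz: "x - \<beta> j \<noteq> 0"
      proof
        assume "x - \<beta> j = 0"
        with False g that J have "(\<Prod>j\<in>J. ((x - \<beta> j) ^ e j) ^ g) = 0"
          by (intro prod_zero) (auto intro!: bexI[of _ j])
        with eps \<open>\<epsilon> \<noteq> 0\<close> show False by simp
      qed
      \<comment> \<open>Multiplied over \<open>j\<close>, the surplus exponents
        \<open>P k j * g\<close> contribute the constant \<open>\<epsilon> ^ k\<close>.\<close>
      have "d * (G k j * r) = d * (H k j + P k j * g)"
      proof -
        have "d * (G k j * r) = (d * G k j) * r" by simp
        also have "\<dots> = r * P (k' k) j + r\<^sup>2 * P k j" by (simp add: dG algebra_simps power2_eq_square)
        also have "r\<^sup>2 * P k j = P k j + (r\<^sup>2 - 1) * P k j"
          using r1 by (simp add: algebra_simps)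
        also have "r * P (k' k) j + (P k j + (r\<^sup>2 - 1) * P k j) = d * H k j + g * d * P k j"
          by (simp add: dH gd)
        finally show ?thesis by (simp add: algebra_simps)
      qed
      hence Gr: "G k j * r = H k j + P k j * g" using d(1) by simp
      have "e j * g * k = (r\<^sup>2 - 1) * ((k * e j) div d) + P k j * g"
      proof -
        have "e j * g * k = (d * ((k * e j) div d) + P k j) * g"
          unfolding P_def by (simp add: mult_ac)
        thus ?thesis unfolding gd[symmetric] by (simp add: algebra_simps)
      qed
      hence "(((x - \<beta> j) ^ e j) ^ g) ^ k
          = ((x - \<beta> j) ^ (r\<^sup>2 - 1)) ^ ((k * e j) div d) * (x - \<beta> j) ^ (P k j * g)"
        by (simp only: power_add flip: power_mult)
      hence "(((x - \<beta> j) ^ e j) ^ g) ^ k = (x - \<beta> j) ^ (P k j * g)"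
        by (simp only: power_q_minus_1[OF nz] power_one mult_1)
      hence "(((x - \<beta> j) ^ e j) ^ g) ^ k * (x - \<beta> j) ^ H k j = (x - \<beta> j) ^ (H k j + P k j * g)"
        by (simp only: power_add mult.commute)
      thus ?thesis by (simp only: Gr flip: power_mult)
    qed
    have "poly (b t) x ^ r = x ^ (r * i + r * r * a) * (\<Prod>j\<in>J. ((x - \<beta> j) ^ G k j) ^ r)"
      by (simp add: t' b_def poly_monom poly_prod power_mult_distrib prod_power_distrib algebra_simps flip: power_mult)
    also have "x ^ (r * i + r * r * a) = x ^ (r * i + a)"
      by (simp add: power_add power_mult[of _ "r * r"] power_r_r)
    also have "(\<Prod>j\<in>J. ((x - \<beta> j) ^ G k j) ^ r)
        = (\<Prod>j\<in>J. (((x - \<beta> j) ^ e j) ^ g) ^ k * (x - \<beta> j) ^ H k j)"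
      using factor by (intro prod.cong) auto
    also have "\<dots> = \<epsilon> ^ k * (\<Prod>j\<in>J. (x - \<beta> j) ^ H k j)"
      by (simp add: prod.distrib eps prod_power_distrib)
    finally show "poly (b t) x ^ r = poly (U t) x"
      by (simp add: t' U_def poly_monom poly_prod)
  qed (use fin inj b_nz deg_b_le deg_U_less M_less in auto)
  hence "d * card T \<le> d * N" by simp
  also have "\<dots> \<le> r - 1 + r * m" by (simp add: N_def)
  also have "\<dots> \<le> r\<^sup>2 + (c + 1) * r" by (simp add: m_def algebra_simps power2_eq_square)
  finally show ?thesis by (simp add: T_def g_def)
qed

end

section \<open>Octic character sums\<close>

text \<open>The order is exactly \<open>8\<close>: \<open>n\<close> is halved repeatedly, using that
  \<open>-1\<close> has order \<open>2\<close>. The field is arbitrary because this serves both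
  \<open>\<zeta>\<close> in the finite field and \<open>\<omega>\<close> in the complex
  numbers.\<close>

lemma power_eq_1_iff_8_dvd:
  fixes u :: "'b::field"
  assumes u: "u ^ 4 = -1" and neq: "(-1 :: 'b) \<noteq> 1"
  shows "u ^ n = 1 \<longleftrightarrow> 8 dvd n"
proof
  assume "8 dvd n"
  then obtain m where "n = 8 * m" by (auto elim: dvdE)
  moreover have "u ^ 8 = (u ^ 4) ^ 2" by (simp flip: power_mult)
  ultimately show "u ^ n = 1" using u by (simp add: power_mult)
next
  assume n: "u ^ n = 1"
  have "(-1 :: 'b) ^ n = (u ^ n) ^ 4" by (simp add: mult.commute flip: u power_mult)
  hence "even n" using n neq by (cases "even n") auto
  then obtain m where m: "n = 2 * m" by (auto elim: evenE)
  have "(-1 :: 'b) ^ m = (u ^ n) ^ 2" by (simp add: m mult.commute flip: u power_mult)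
  hence "even m" using n neq by (cases "even m") auto
  then obtain l where l: "m = 2 * l" by (auto elim: evenE)
  have "(-1 :: 'b) ^ l = u ^ n" by (simp add: m l flip: u power_mult)
  hence "even l" using n neq by (cases "even l") auto
  thus "8 dvd n" by (auto simp: m l elim!: evenE)
qed

lemma power_eq_power_iff_cong_8:
  fixes u :: "'b::field"
  assumes u: "u ^ 4 = -1" and neq: "(-1 :: 'b) \<noteq> 1"
  shows "u ^ k = u ^ l \<longleftrightarrow> k mod 8 = l mod 8"
proof -
  have *: "u ^ k = u ^ l \<longleftrightarrow> k mod 8 = l mod 8" if "k \<le> l" for k l
  proof -
    have "u \<noteq> 0" using u by auto
    have "u ^ l = u ^ k * u ^ (l - k)" using that by (simp flip: power_add)
    hence "u ^ k = u ^ l \<longleftrightarrow> u ^ (l - k) = 1" using \<open>u \<noteq> 0\<close> by simp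
    also have "\<dots> \<longleftrightarrow> 8 dvd l - k" by (rule power_eq_1_iff_8_dvd[OF u neq])
    also have "\<dots> \<longleftrightarrow> k mod 8 = l mod 8" using that mod_eq_dvd_iff_nat by metis
    finally show ?thesis .
  qed
  show ?thesis using *[of k l] *[of l k] by (cases "k \<le> l") auto
qed

lemma coprime_8_of_odd:
  assumes "odd (n::nat)"
  shows "coprime n 8"
proof -
  have "coprime n (2 ^ 3)"
    unfolding coprime_power_right_iff using assms by (simp add: coprime_right_2_iff_odd)
  thus ?thesis by simp
qed

lemma sum_powers_root_of_unity:
  fixes z :: "'b::field"
  assumes "z ^ n = 1" "z \<noteq> 1"
  shows "(\<Sum>k<n. z ^ k) = 0"
  using assms by (simp add: sum_gp_strict)

text \<open>Orthogonality: the product over \<open>i\<close> of the sums of \<open>v i a ^ k\<close>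
  for \<open>k < n i\<close> vanishes unless every \<open>v i a\<close> is \<open>1\<close>. If no
  such \<open>a\<close> existed, the trivial term \<open>card X\<close> would be cancelled by
  nontrivial sums of size at most \<open>B\<close> each.\<close>

lemma exists_all_eq_1_of_sum_bound:
  fixes v :: "'i \<Rightarrow> 'x \<Rightarrow> complex"
  assumes fin: "finite I" "finite X"
    and n: "\<And>i. i \<in> I \<Longrightarrow> n i > (0::nat)"
    and v: "\<And>i a. i \<in> I \<Longrightarrow> a \<in> X \<Longrightarrow> v i a ^ n i = 1"
    and B: "\<And>t. t \<in> PiE I (\<lambda>i. {..<n i}) \<Longrightarrow> \<exists>i\<in>I. t i \<noteq> 0 \<Longrightarrow>
              norm (\<Sum>a\<in>X. \<Prod>i\<in>I. v i a ^ t i) \<le> B"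
    and big: "real (\<Prod>i\<in>I. n i) * B < real (card X)" "B \<ge> 0"
  shows "\<exists>a\<in>X. \<forall>i\<in>I. v i a = 1"
proof (rule ccontr)
  assume contra: "\<not> (\<exists>a\<in>X. \<forall>i\<in>I. v i a = 1)"
  let ?P = "PiE I (\<lambda>i. {..<n i})"
  define S where "S t = (\<Sum>a\<in>X. \<Prod>i\<in>I. v i a ^ t i)" for t
  define o' where "o' = (\<lambda>i\<in>I. 0 :: nat)"
  have finP: "finite ?P" using fin by (intro finite_PiE) auto
  have o': "o' \<in> ?P" using n by (auto simp: o'_def)
  have "(\<Sum>t\<in>?P. S t) = (\<Sum>a\<in>X. \<Prod>i\<in>I. \<Sum>k<n i. v i a ^ k)"
    unfolding S_def using fin by (subst sum.swap) (simp add: prod_sum_PiE)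
  also have "\<dots> = 0"
  proof (rule sum.neutral, rule ballI)
    fix a assume a: "a \<in> X"
    then obtain i where i: "i \<in> I" "v i a \<noteq> 1" using contra by blast
    hence "(\<Sum>k<n i. v i a ^ k) = 0" using a v by (intro sum_powers_root_of_unity) auto
    thus "(\<Prod>i\<in>I. \<Sum>k<n i. v i a ^ k) = 0" using fin i by auto
  qed
  finally have "S o' + (\<Sum>t\<in>?P - {o'}. S t) = 0" using finP o' by (simp add: sum.remove)
  moreover have "S o' = of_nat (card X)" by (simp add: S_def o'_def)
  ultimately have "of_nat (card X) = - (\<Sum>t\<in>?P - {o'}. S t)"
    by (simp add: eq_neg_iff_add_eq_0)
  hence "real (card X) = norm (\<Sum>t\<in>?P - {o'}. S t)"
    by (metis norm_minus_cancel norm_of_nat)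
  also have "\<dots> \<le> (\<Sum>t\<in>?P - {o'}. B)"
  proof (rule sum_norm_le)
    fix t assume t: "t \<in> ?P - {o'}"
    hence "\<exists>i\<in>I. t i \<noteq> 0"
      using PiE_ext[of t I "\<lambda>i. {..<n i}" o'] o' by (auto simp: o'_def)
    thus "norm (S t) \<le> B" unfolding S_def using B t by blast
  qed
  also have "\<dots> \<le> (\<Sum>t\<in>?P. B)" using finP big(2) by (intro sum_mono2) auto
  also have "\<dots> = real (\<Prod>i\<in>I. n i) * B" using fin by (simp add: card_PiE)
  finally show False using big(1) by simp
qed

text \<open>Upper bounds on the class sizes suffice. As the powers of \<open>z\<close> sum to zero,
  \<open>N k\<close> may be replaced by the nonnegative deficit \<open>A / d - N k\<close>, and the
  triangle inequality gives the total deficit.\<close>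

lemma norm_weighted_root_sum_le:
  fixes z :: complex and N :: "nat \<Rightarrow> nat"
  assumes z: "norm z = 1" "z ^ d = 1" "z \<noteq> 1" and "d > 0"
    and N: "\<And>k. k < d \<Longrightarrow> real d * real (N k) \<le> A"
  shows "norm (\<Sum>k<d. of_nat (N k) * z ^ k) \<le> A - real (\<Sum>k<d. N k)"
proof -
  define b where "b = A / real d"
  have le: "real (N k) \<le> b" if "k < d" for k
    using N[OF that] \<open>d > 0\<close> by (simp add: b_def field_simps)
  have "(\<Sum>k<d. of_nat (N k) * z ^ k) = - (\<Sum>k<d. of_real (b - real (N k)) * z ^ k)"
    using sum_powers_root_of_unity[OF z(2,3)]
    by (simp add: left_diff_distrib sum_subtractf flip: sum_distrib_left)
  also have "norm \<dots> = norm (\<Sum>k<d. of_real (b - real (N k)) * z ^ k)"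
    by (rule norm_minus_cancel)
  also have "\<dots> \<le> (\<Sum>k<d. b - real (N k))"
    using le z(1) by (intro sum_norm_le) (simp add: norm_mult norm_power del: of_real_diff)
  also have "\<dots> = A - real (\<Sum>k<d. N k)" using \<open>d > 0\<close> by (simp add: sum_subtractf b_def)
  finally show ?thesis .
qed

context quadratic_field begin

text \<open>The polynomial \<open>x ^ n - 1\<close> has at most \<open>n\<close> roots. This yields
  the needed roots of unity without a generator of the unit group.\<close>

lemma exists_power_neq_1:
  assumes "0 < n" "n < r\<^sup>2 - 1"
  shows "\<exists>u::'a. u \<noteq> 0 \<and> u ^ n \<noteq> 1"
proof (rule ccontr)
  assume "\<not> ?thesis"
  hence *: "u ^ n = 1" if "u \<noteq> 0" for u :: 'a using that by blast
  let ?p = "monom 1 n - 1 :: 'a poly"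
  have deg: "degree ?p \<le> n" by (rule degree_diff_le) (auto simp: degree_monom_le)
  have "coeff ?p n = 1" using assms by (simp add: coeff_eq_0)
  hence "?p \<noteq> 0" by (metis coeff_0 zero_neq_one)
  have "card (UNIV - {0::'a}) \<le> card {x. poly ?p x = 0}"
    using * by (intro card_mono) (auto simp: poly_monom)
  also have "\<dots> \<le> degree ?p" by (rule card_poly_roots_bound) fact
  also note deg
  finally show False using assms by (simp add: card_field card_Diff_singleton)
qed

end

section \<open>The octic residue character and its sums\<close>

locale octic_field = quadratic_field r ty
  for r :: nat and ty :: "'a::{finite,field} itself" +
  fixes \<zeta> :: 'a and g :: nat
  assumes zeta_4: "\<zeta> ^ 4 = -1" and neg_1_neq_1: "(-1 :: 'a) \<noteq> 1"
    and g: "8 * g = r\<^sup>2 - 1"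
begin

lemmas zeta_power_eq_iff = power_eq_power_iff_cong_8[OF zeta_4 neg_1_neq_1]
lemmas zeta_power_eq_1_iff = power_eq_1_iff_8_dvd[OF zeta_4 neg_1_neq_1]

lemma zeta_nz: "\<zeta> \<noteq> 0" using zeta_4 by auto

lemma roots_of_unity_8: "{z::'a. z ^ 8 = 1} = (\<lambda>k. \<zeta> ^ k) ` {..<8}" "card {z::'a. z ^ 8 = 1} = 8"
proof -
  let ?p = "monom 1 8 - 1 :: 'a poly"
  have "coeff ?p 8 = 1" by (simp add: coeff_eq_0)
  hence nz: "?p \<noteq> 0" by (metis coeff_0 zero_neq_one)
  have deg: "degree ?p \<le> 8" by (rule degree_diff_le) (auto simp: degree_monom_le)
  have "card {z::'a. z ^ 8 = 1} = card {z. poly ?p z = 0}" by (simp add: poly_monom)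
  also have "\<dots> \<le> 8" using card_poly_roots_bound[OF nz] deg by simp
  finally have le: "card {z::'a. z ^ 8 = 1} \<le> 8" .
  have "inj_on (\<lambda>k. \<zeta> ^ k) {..<8}" by (auto simp: inj_on_def zeta_power_eq_iff)
  hence c: "card ((\<lambda>k. \<zeta> ^ k) ` {..<8}) = 8" by (simp add: card_image)
  have sub: "(\<lambda>k. \<zeta> ^ k) ` {..<8} \<subseteq> {z. z ^ 8 = 1}"
    by (auto simp: zeta_power_eq_1_iff simp flip: power_mult)
  show "{z::'a. z ^ 8 = 1} = (\<lambda>k. \<zeta> ^ k) ` {..<8}"
    using card_seteq[OF _ sub] le c by simp
  thus "card {z::'a. z ^ 8 = 1} = 8" using c by simp
qed

lemma power_8_eq_1D: "(z::'a) ^ 8 = 1 \<Longrightarrow> \<exists>k<8. z = \<zeta> ^ k"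
  using roots_of_unity_8(1) by blast

lemma power_g: "(x::'a) \<noteq> 0 \<Longrightarrow> \<exists>k<8. x ^ g = \<zeta> ^ k"
  by (intro power_8_eq_1D) (metis g mult.commute power_mult power_q_minus_1)

definition \<omega> :: complex where "\<omega> = cis (pi / 4)"

lemma omega_4: "\<omega> ^ 4 = -1" by (simp add: \<omega>_def DeMoivre)

lemma norm_omega: "norm \<omega> = 1" by (simp add: \<omega>_def)

lemma omega_power_eq_iff: "\<omega> ^ k = \<omega> ^ l \<longleftrightarrow> k mod 8 = l mod 8"
  by (intro power_eq_power_iff_cong_8 omega_4) simp

lemma omega_power_eq_1_iff: "\<omega> ^ k = 1 \<longleftrightarrow> 8 dvd k"
  by (intro power_eq_1_iff_8_dvd omega_4) simp

text \<open>The octic residue symbol \<open>x ^ g\<close>, transported to the complex numbers by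
  \<open>\<zeta> \<mapsto> \<omega>\<close>. At \<open>0\<close> no exponent qualifies and the value
  is arbitrary, so multiplicativity is stated for nonzero arguments.\<close>

definition \<chi> :: "'a \<Rightarrow> complex" where "\<chi> x = \<omega> ^ (SOME k. x ^ g = \<zeta> ^ k)"

lemma chi_eq: "x ^ g = \<zeta> ^ k \<Longrightarrow> \<chi> x = \<omega> ^ k"
  unfolding \<chi>_def by (rule someI2[of _ k]) (auto simp: omega_power_eq_iff zeta_power_eq_iff)

lemma chi_1 [simp]: "\<chi> 1 = 1"
  using chi_eq[of 1 0] by simp

lemma chi_mult:
  assumes "x \<noteq> 0" "y \<noteq> 0"
  shows "\<chi> (x * y) = \<chi> x * \<chi> y"
proof -
  obtain k l where "x ^ g = \<zeta> ^ k" "y ^ g = \<zeta> ^ l" using power_g assms by metis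
  thus ?thesis using chi_eq[of "x * y" "k + l"] by (simp add: chi_eq power_mult_distrib power_add)
qed

lemma chi_power: "x \<noteq> 0 \<Longrightarrow> \<chi> (x ^ n) = \<chi> x ^ n"
  by (induction n) (simp_all add: chi_mult)

lemma chi_prod: "(\<And>i. i \<in> I \<Longrightarrow> f i \<noteq> 0) \<Longrightarrow> \<chi> (\<Prod>i\<in>I. f i) = (\<Prod>i\<in>I. \<chi> (f i))"
  by (induction I rule: infinite_finite_induct) (simp_all add: chi_mult)

lemma chi_eq_1_iff: "x \<noteq> 0 \<Longrightarrow> \<chi> x = 1 \<longleftrightarrow> x ^ g = 1"
  using power_g[of x] by (auto simp: chi_eq omega_power_eq_1_iff zeta_power_eq_1_iff)

text \<open>Zero is excluded because the binomial needs a nonzero coefficient, the eighth roots of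
  unity because every \<open>- (\<zeta> ^ j)\<close> is one of them.\<close>

definition X :: "'a set" where "X = {a. a \<noteq> 0 \<and> a ^ 8 \<noteq> 1}"

lemma X_add_nz: "a \<in> X \<Longrightarrow> a + \<zeta> ^ j \<noteq> 0"
proof
  assume "a \<in> X" "a + \<zeta> ^ j = 0"
  hence "a = - (\<zeta> ^ j)" by (simp add: eq_neg_iff_add_eq_0)
  hence "a ^ 8 = 1" by (simp add: zeta_power_eq_1_iff flip: power_mult)
  with \<open>a \<in> X\<close> show False by (simp add: X_def)
qed

lemma card_X: "card X + 9 = r\<^sup>2"
proof -
  let ?Z = "insert 0 {z::'a. z ^ 8 = 1}"
  have X: "X = UNIV - ?Z" by (auto simp: X_def)
  have Z: "card ?Z = 9" by (simp add: roots_of_unity_8(2))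
  have "card ?Z \<le> card (UNIV :: 'a set)" by (intro card_mono) auto
  moreover have "card X = card (UNIV :: 'a set) - card ?Z"
    unfolding X by (rule card_Diff_subset) auto
  ultimately show ?thesis unfolding Z card_field by linarith
qed

text \<open>
  The substitution \<open>x = 1 / (a + \<zeta>\<^sup>j)\<close> with \<open>e j\<close> odd moves a totally ramified point of the
  curve \<open>y\<^sup>d = \<Prod> (a + \<zeta>\<^sup>j)\<^bsup>e j\<^esup>\<close> to infinity.
\<close>
lemma card_octic_class_le:
  fixes e :: "nat \<Rightarrow> nat"
  assumes hd: "h * d = 8" "d > 1" and sum: "d dvd (\<Sum>j<8. e j)"
    and j0: "j0 < 8" "odd (e j0)" and r: "r > 1300" and "\<epsilon> \<noteq> 0"
  shows "d * card {a\<in>X. (\<Prod>j<8. (a + \<zeta> ^ j) ^ e j) ^ (h * g) = \<epsilon>} \<le> r\<^sup>2 + 50 * r"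
proof -
  define J where "J = {..<8::nat} - {j0}"
  define \<delta> where "\<delta> j = \<zeta> ^ j - \<zeta> ^ j0" for j
  define \<beta> where "\<beta> j = - 1 / \<delta> j" for j
  define C where "C = (\<Prod>j\<in>J. \<delta> j ^ e j) ^ (h * g)"
  have delta: "\<delta> j \<noteq> 0" if "j \<in> J" for j
    using that j0 by (auto simp: \<delta>_def J_def zeta_power_eq_iff)
  have C: "C \<noteq> 0" using delta by (simp add: C_def J_def)
  have J: "finite J" "card J = 7" using j0 by (auto simp: J_def)
  have "d dvd 8" using hd(1) by (metis dvd_triv_right)
  have d8: "d \<le> 8" using \<open>d dvd 8\<close> by (rule dvd_imp_le) simp
  have hg: "(r\<^sup>2 - 1) div d = h * g"
  proof -
    have "r\<^sup>2 - 1 = (h * g) * d" unfolding g[symmetric] hd(1)[symmetric] by (simp add: mult_ac)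
    thus ?thesis using hd(2) by simp
  qed
  have sumJ: "(\<Sum>j<8. e j) = e j0 + (\<Sum>j\<in>J. e j)"
    unfolding J_def using j0 by (intro sum.remove) auto
  have "even d"
  proof (rule ccontr)
    assume "odd d"
    hence "coprime d 8" by (rule coprime_8_of_odd)
    with \<open>d dvd 8\<close> have "d dvd 1" by (simp add: coprime_absorb_left)
    with hd(2) show False by simp
  qed
  \<comment> \<open>The full sum is divisible by the even number \<open>d\<close>, so removing the
    odd \<open>e j0\<close> leaves an odd sum.\<close>
  hence "odd (\<Sum>j\<in>J. e j)" using j0 sum sumJ dvd_trans by (metis even_add)
  hence "coprime (\<Sum>j\<in>J. e j) 8" by (rule coprime_8_of_odd)
  hence cop: "coprime (\<Sum>j\<in>J. e j) d" using \<open>d dvd 8\<close> by (rule coprime_divisors[OF dvd_refl, rotated])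
  define T where "T = {x. (\<Prod>j\<in>J. (x - \<beta> j) ^ e j) ^ (h * g) = \<epsilon> / C}"
  define c where "c = card J * (d - 1)"
  \<comment> \<open>Seven factors and \<open>d \<le> 8\<close> give \<open>7 * 7\<close>. Hence the
    coefficient \<open>50 = 49 + 1\<close>, and \<open>2401 + 147 + 16 < 2 * 1300\<close> explains
    the bound \<open>1300\<close>.\<close>
  have c49: "c \<le> 49" using J d8 by (simp add: c_def)
  have "c\<^sup>2 \<le> 49\<^sup>2" using c49 by (intro power_mono) auto
  hence "c\<^sup>2 + 3 * c + 2 * d < 2 * r" using c49 d8 r by simp
  moreover have "d dvd r\<^sup>2 - 1" using \<open>d dvd 8\<close> g by (metis dvd_mult2)
  ultimately have "d * card T \<le> r\<^sup>2 + (c + 1) * r"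
    unfolding T_def hg[symmetric] using J hd(2) cop C \<open>\<epsilon> \<noteq> 0\<close>
    by (intro card_power_residue_class_le[OF _ _ _ _ c_def]) auto
  also have "\<dots> \<le> r\<^sup>2 + 50 * r" using c49 by simp
  finally have T: "d * card T \<le> r\<^sup>2 + 50 * r" .
  have "card {a\<in>X. (\<Prod>j<8. (a + \<zeta> ^ j) ^ e j) ^ (h * g) = \<epsilon>} \<le> card T"
  proof (rule card_inj_on_le[where f = "\<lambda>a. 1 / (a + \<zeta> ^ j0)"])
    show "inj_on (\<lambda>a. 1 / (a + \<zeta> ^ j0)) {a\<in>X. (\<Prod>j<8. (a + \<zeta> ^ j) ^ e j) ^ (h * g) = \<epsilon>}"
      by (auto simp: inj_on_def divide_inverse)
    show "(\<lambda>a. 1 / (a + \<zeta> ^ j0)) ` {a\<in>X. (\<Prod>j<8. (a + \<zeta> ^ j) ^ e j) ^ (h * g) = \<epsilon>} \<subseteq> T"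
    proof clarify
      fix a assume a: "a \<in> X" and eps: "\<epsilon> = (\<Prod>j<8. (a + \<zeta> ^ j) ^ e j) ^ (h * g)"
      define y where "y = a + \<zeta> ^ j0"
      have y: "y \<noteq> 0" using X_add_nz a by (simp add: y_def)
      have fac: "a + \<zeta> ^ j = y * (\<delta> j * (1 / y - \<beta> j))" if "j \<in> J" for j
      proof -
        have "y * (\<delta> j * (1 / y - \<beta> j)) = y + \<delta> j"
          using y delta[OF that] by (simp add: \<beta>_def field_simps)
        thus ?thesis by (simp add: y_def \<delta>_def)
      qed
      have "(\<Prod>j<8. (a + \<zeta> ^ j) ^ e j) = y ^ e j0 * (\<Prod>j\<in>J. (a + \<zeta> ^ j) ^ e j)"
        unfolding J_def y_def using j0 by (intro prod.remove) auto
      also have "(\<Prod>j\<in>J. (a + \<zeta> ^ j) ^ e j)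
          = (\<Prod>j\<in>J. y ^ e j * (\<delta> j ^ e j * (1 / y - \<beta> j) ^ e j))"
        by (intro prod.cong refl) (simp only: fac power_mult_distrib)
      also have "\<dots> = y ^ (\<Sum>j\<in>J. e j) * ((\<Prod>j\<in>J. \<delta> j ^ e j) * (\<Prod>j\<in>J. (1 / y - \<beta> j) ^ e j))"
        by (simp add: prod.distrib power_sum)
      finally have "\<epsilon> = (y ^ (\<Sum>j<8. e j)) ^ (h * g) * C * (\<Prod>j\<in>J. (1 / y - \<beta> j) ^ e j) ^ (h * g)"
        by (simp add: eps C_def sumJ power_add power_mult_distrib mult_ac)
      \<comment> \<open>The accumulated power of \<open>y\<close> disappears because the total
        exponent is divisible by \<open>d\<close>.\<close>
      moreover have "(y ^ (\<Sum>j<8. e j)) ^ (h * g) = 1"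
      proof -
        obtain s where s: "(\<Sum>j<8. e j) = d * s" using sum by (auto elim: dvdE)
        have "d * s * (h * g) = (h * d) * g * s" by (simp add: mult_ac)
        hence "(\<Sum>j<8. e j) * (h * g) = (r\<^sup>2 - 1) * s" unfolding s hd(1) g .
        hence "(y ^ (\<Sum>j<8. e j)) ^ (h * g) = (y ^ (r\<^sup>2 - 1)) ^ s"
          by (simp only: flip: power_mult)
        thus ?thesis by (simp only: power_q_minus_1[OF y] power_one)
      qed
      ultimately show "1 / (a + \<zeta> ^ j0) \<in> T"
        using C by (simp add: T_def field_simps flip: eps y_def)
    qed
  qed simp
  with T show ?thesis using mult_le_mono2 order_trans by blast
qed

text \<open>Splitting off a common factor \<open>h\<close> of the exponents leaves a character of
  order \<open>d = 8 / h\<close> and some odd exponent. Each of the \<open>d\<close> classes has at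
  most \<open>(r\<^sup>2 + 50 * r) / d\<close> elements, and together they hold
  \<open>r\<^sup>2 - 9\<close>, so the total deficit is \<open>50 * r + 9\<close>.\<close>

lemma octic_character_sum_le:
  fixes e :: "nat \<Rightarrow> nat"
  assumes sum: "8 dvd (\<Sum>j<8. e j)" and nz: "\<not> (\<forall>j<8. 8 dvd e j)" and r: "r > 1300"
  shows "norm (\<Sum>a\<in>X. \<chi> (\<Prod>j<8. (a + \<zeta> ^ j) ^ e j)) \<le> 50 * real r + 9"
proof -
  \<comment> \<open>\<open>h\<close> is the largest of \<open>1\<close>, \<open>2\<close>,
    \<open>4\<close> dividing all exponents, so some quotient is odd.\<close>
  have "\<exists>h d j0 e'. h * d = 8 \<and> d > 1 \<and> j0 < 8 \<and> odd (e' j0 :: nat) \<and> (\<forall>j<8. e j = h * e' j)"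
  proof (cases "\<forall>j<8. 4 dvd e j")
    case True
    with nz obtain j0 where "j0 < 8" "\<not> 8 dvd e j0" by blast
    with True show ?thesis
      by (intro exI[of _ 4] exI[of _ 2] exI[of _ j0] exI[of _ "\<lambda>j. e j div 4"])
         (auto elim!: dvdE evenE)
  next
    case no4: False
    show ?thesis
    proof (cases "\<forall>j<8. 2 dvd e j")
      case True
      from no4 obtain j0 where "j0 < 8" "\<not> 4 dvd e j0" by blast
      with True show ?thesis
        by (intro exI[of _ 2] exI[of _ 4] exI[of _ j0] exI[of _ "\<lambda>j. e j div 2"])
           (auto elim!: dvdE evenE)
    next
      case False
      then obtain j0 where "j0 < 8" "odd (e j0)" by blast
      thus ?thesis
        by (intro exI[of _ 1] exI[of _ 8] exI[of _ j0] exI[of _ e]) auto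
    qed
  qed
  then obtain h d j0 e' where hd: "h * d = 8" "d > 1" and j0: "j0 < 8" "odd (e' j0 :: nat)"
    and e': "\<And>j. j < 8 \<Longrightarrow> e j = h * e' j" by blast
  have h: "h > 0" using hd by (cases h) auto
  define F where "F a = (\<Prod>j<8. (a + \<zeta> ^ j) ^ e' j)" for a
  have F_nz: "F a \<noteq> 0" if "a \<in> X" for a using X_add_nz that by (simp add: F_def)
  have F_e: "(\<Prod>j<8. (a + \<zeta> ^ j) ^ e j) = F a ^ h" for a
    by (simp add: F_def e' prod_power_distrib mult.commute flip: power_mult)
  have "h * d dvd h * (\<Sum>j<8. e' j)" using sum e' hd by (simp add: sum_distrib_left)
  hence sum': "d dvd (\<Sum>j<8. e' j)" using h by simp
  define Y where "Y k = {a\<in>X. F a ^ (h * g) = \<zeta> ^ (h * k)}" for k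
  have X_eq: "X = (\<Union>k<d. Y k)"
  proof (intro equalityI subsetI)
    fix a assume a: "a \<in> X"
    obtain l where l: "l < 8" "F a ^ g = \<zeta> ^ l" using power_g F_nz a by blast
    have "F a ^ (h * g) = \<zeta> ^ (h * l)" by (simp add: l(2) mult.commute[of h] power_mult)
    also have "\<dots> = \<zeta> ^ (h * (l mod d))"
      unfolding zeta_power_eq_iff hd(1)[symmetric] mult_mod_right[symmetric] by simp
    finally show "a \<in> (\<Union>k<d. Y k)" using a hd(2) by (auto simp: Y_def)
  qed (auto simp: Y_def)
  have disj: "Y k \<inter> Y l = {}" if "k < d" "l < d" "k \<noteq> l" for k l
  proof -
    have "h * k < 8" "h * l < 8" using that h by (simp_all flip: hd(1))
    thus ?thesis using that h by (auto simp: Y_def zeta_power_eq_iff)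
  qed
  have "(\<Sum>a\<in>X. \<chi> (F a ^ h)) = (\<Sum>k<d. \<Sum>a\<in>Y k. \<chi> (F a ^ h))"
    unfolding X_eq by (rule sum.UNION_disjoint) (use disj in \<open>auto\<close>)
  also have "\<dots> = (\<Sum>k<d. \<Sum>a\<in>Y k. (\<omega> ^ h) ^ k)"
    by (intro sum.cong refl) (auto simp: Y_def chi_eq simp flip: power_mult)
  also have "\<dots> = (\<Sum>k<d. of_nat (card (Y k)) * (\<omega> ^ h) ^ k)" by simp
  finally have eq: "(\<Sum>a\<in>X. \<chi> (\<Prod>j<8. (a + \<zeta> ^ j) ^ e j)) = \<dots>" by (simp add: F_e)
  have "h < 8"
  proof (rule ccontr)
    assume "\<not> h < 8"
    hence "8 * 2 \<le> h * d" using hd(2) by (intro mult_le_mono) auto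
    with hd(1) show False by simp
  qed
  hence "\<omega> ^ h \<noteq> 1" using h by (auto simp: omega_power_eq_1_iff dest: dvd_imp_le)
  moreover have "(\<omega> ^ h) ^ d = 1" using hd(1) by (simp add: omega_power_eq_1_iff flip: power_mult)
  moreover have "real d * real (card (Y k)) \<le> real (r\<^sup>2 + 50 * r)" for k
    unfolding of_nat_mult[symmetric] of_nat_le_iff Y_def F_def
    using hd sum' j0 r zeta_nz by (intro card_octic_class_le) auto
  ultimately have "norm (\<Sum>k<d. of_nat (card (Y k)) * (\<omega> ^ h) ^ k)
      \<le> real (r\<^sup>2 + 50 * r) - real (\<Sum>k<d. card (Y k))"
    by (intro norm_weighted_root_sum_le) (use hd in \<open>auto simp: norm_power norm_omega\<close>)
  also have "(\<Sum>k<d. card (Y k)) = card X"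
    unfolding X_eq by (rule card_UN_disjoint[symmetric]) (use disj in auto)
  also have "real (r\<^sup>2 + 50 * r) - real (card X) = 50 * real r + 9"
    using arg_cong[OF card_X, of real] by simp
  finally show ?thesis by (simp add: eq)
qed

end

section \<open>A binomial separating 1 from -1\<close>

text \<open>
  Let \<open>w\<^sub>j = (a + \<zeta>\<^sup>j)\<^sup>g\<close>. The seven rows encode that \<open>w\<^sub>j\<^sup>4\<close> is constant, that \<open>w\<^sub>j\<^sup>2\<close> depends only on
  \<open>j mod 2\<close>, and \<open>w\<^sub>j\<close> only on \<open>j mod 4\<close>, so that \<open>\<zeta>\<^sup>j w\<^sub>j\<close> determines \<open>j\<close> modulo \<open>2\<close>, \<open>4\<close> and \<open>8\<close>
  successively; the exponents \<open>6\<close> and \<open>7\<close> stand for \<open>-2\<close> and \<open>-1\<close>.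
\<close>
definition pattern_exp :: "nat \<Rightarrow> nat \<Rightarrow> nat" where
  "pattern_exp i j =
     [[4,4,0,0,0,0,0,0],
      [6,0,2,0,0,0,0,0], [0,6,0,2,0,0,0,0],
      [7,0,0,0,1,0,0,0], [0,7,0,0,0,1,0,0], [0,0,7,0,0,0,1,0], [0,0,0,7,0,0,0,1]] ! i ! j"

text \<open>Every entry of row \<open>i\<close> is a multiple of \<open>8 / pattern_ord i\<close>,
  so the character value of the row has order dividing \<open>pattern_ord i\<close>. The product of
  these numbers is \<open>2 ^ 17\<close>.\<close>

definition pattern_ord :: "nat \<Rightarrow> nat" where
  "pattern_ord i = [2, 4, 4, 8, 8, 8, 8] ! i"

lemma all_less_7: "(\<forall>i<7. Q i) \<longleftrightarrow> Q 0 \<and> Q 1 \<and> Q 2 \<and> Q 3 \<and> Q 4 \<and> Q 5 \<and> Q (6::nat)"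
  by (simp add: eval_nat_numeral All_less_Suc) blast

lemma all_less_8: "(\<forall>i<8. Q i) \<longleftrightarrow> Q 0 \<and> Q 1 \<and> Q 2 \<and> Q 3 \<and> Q 4 \<and> Q 5 \<and> Q 6 \<and> Q (7::nat)"
  by (simp add: eval_nat_numeral All_less_Suc) blast

lemma lessThan_7: "{..<7::nat} = {0, 1, 2, 3, 4, 5, 6}" by auto

lemma lessThan_8: "{..<8::nat} = {0, 1, 2, 3, 4, 5, 6, 7}" by auto

text \<open>The representatives \<open>6\<close> and \<open>7\<close> give every row a total
  divisible by \<open>8\<close>, as the character sum bound requires.\<close>

lemma sum_pattern_exp: "i < 7 \<Longrightarrow> (\<Sum>j<8. pattern_exp i j) = 8"
proof -
  have "\<forall>i<7. (\<Sum>j<8. pattern_exp i j) = 8"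
    unfolding all_less_7 lessThan_8 by (simp add: pattern_exp_def)
  thus "i < 7 \<Longrightarrow> ?thesis" by blast
qed

lemma pattern_exp_ord_dvd: "i < 7 \<Longrightarrow> j < 8 \<Longrightarrow> 8 dvd pattern_exp i j * pattern_ord i"
proof -
  have "\<forall>i<7. \<forall>j<8. 8 dvd pattern_exp i j * pattern_ord i"
    unfolding all_less_7 all_less_8 by (simp add: pattern_exp_def pattern_ord_def)
  thus "i < 7 \<Longrightarrow> j < 8 \<Longrightarrow> ?thesis" by blast
qed

text \<open>The system is triangular: columns \<open>4\<close> to \<open>7\<close> isolate
  \<open>t 3\<close> to \<open>t 6\<close>, then columns \<open>2\<close> and \<open>3\<close>
  isolate \<open>t 1\<close> and \<open>t 2\<close>, and column \<open>0\<close> leaves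
  \<open>t 0\<close>. Hence the character sum bound applies to every nontrivial combination of
  rows.\<close>

lemma pattern_combination_eq_0:
  assumes t: "t \<in> PiE {..<7} (\<lambda>i. {..<pattern_ord i})"
    and dvd: "\<forall>j<8. 8 dvd (\<Sum>i<7. t i * pattern_exp i j)"
  shows "\<forall>i<7. t i = 0"
proof -
  have small: "t i < pattern_ord i" if "i < 7" for i using t that by auto
  have lt: "t 0 < 2" "t 1 < 4" "t 2 < 4" "t 3 < 8" "t 4 < 8" "t 5 < 8" "t 6 < 8"
    using small[of 0] small[of 1] small[of 2] small[of 3] small[of 4] small[of 5] small[of 6]
    by (simp_all add: pattern_ord_def)
  have z: "n = 0" if "8 dvd n" "n < 8" for n :: nat using that by (auto dest: dvd_imp_le)
  note e = dvd[unfolded all_less_8 lessThan_7, simplified pattern_exp_def, simplified]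
  have t3: "t 3 = 0" "t 4 = 0" "t 5 = 0" "t 6 = 0" using e lt by (auto intro!: z)
  have "8 dvd t 1 * 2" "8 dvd t 2 * 2" using e t3 by auto
  hence t1: "t 1 = 0" "t 2 = 0" using z[of "t 1 * 2"] z[of "t 2 * 2"] lt by auto
  have "8 dvd t 0 * 4" using e t1 t3 by auto
  hence "t 0 = 0" using z[of "t 0 * 4"] lt by auto
  thus ?thesis unfolding all_less_7 using t1 t3 by simp
qed

section \<open>Choice of the parameter and the resulting permutation binomial\<close>

context octic_field begin

lemma chi_power_8_dvd:
  assumes "x \<noteq> 0" "8 dvd m"
  shows "\<chi> x ^ m = 1"
proof -
  obtain k where "x ^ g = \<zeta> ^ k" using power_g assms by blast
  hence "\<chi> x = \<omega> ^ k" by (rule chi_eq)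
  thus ?thesis using assms by (simp add: omega_power_eq_1_iff flip: power_mult)
qed

text \<open>Orthogonality imposes all seven conditions at once. Each nontrivial combination of rows
  is a single octic character sum with exponents \<open>e j\<close>.\<close>

lemma exists_pattern:
  assumes r: "r \<ge> 10485731"
  shows "\<exists>a\<in>X. \<forall>i<7. (\<Prod>j<8. (a + \<zeta> ^ j) ^ pattern_exp i j) ^ g = 1"
proof -
  define v where "v i a = \<chi> (\<Prod>j<8. (a + \<zeta> ^ j) ^ pattern_exp i j)" for i a
  have v_eq: "v i a = (\<Prod>j<8. \<chi> (a + \<zeta> ^ j) ^ pattern_exp i j)" if "a \<in> X" for i a
    using X_add_nz[OF that] by (simp add: v_def chi_prod chi_power)
  have "\<exists>a\<in>X. \<forall>i\<in>{..<7}. v i a = 1"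
  proof (rule exists_all_eq_1_of_sum_bound[where n = pattern_ord and B = "50 * real r + 9"])
    show "pattern_ord i > 0" if "i \<in> {..<7}" for i
    proof -
      have "\<forall>i<7. pattern_ord i > 0" unfolding all_less_7 by (simp add: pattern_ord_def)
      thus ?thesis using that by simp
    qed
    show "v i a ^ pattern_ord i = 1" if "i \<in> {..<7}" "a \<in> X" for i a
    proof -
      have "v i a ^ pattern_ord i = (\<Prod>j<8. \<chi> (a + \<zeta> ^ j) ^ (pattern_exp i j * pattern_ord i))"
        using that by (simp add: v_eq prod_power_distrib flip: power_mult)
      also have "\<dots> = 1"
        using that X_add_nz pattern_exp_ord_dvd by (intro prod.neutral ballI chi_power_8_dvd) auto
      finally show ?thesis .
    qed
    show "norm (\<Sum>a\<in>X. \<Prod>i\<in>{..<7}. v i a ^ t i) \<le> 50 * real r + 9"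
      if t: "t \<in> PiE {..<7} (\<lambda>i. {..<pattern_ord i})" "\<exists>i\<in>{..<7}. t i \<noteq> 0" for t
    proof -
      define e where "e j = (\<Sum>i<7. t i * pattern_exp i j)" for j
      have "(\<Prod>i\<in>{..<7}. v i a ^ t i) = \<chi> (\<Prod>j<8. (a + \<zeta> ^ j) ^ e j)" if a: "a \<in> X" for a
      proof -
        have "(\<Prod>i\<in>{..<7}. v i a ^ t i) = (\<Prod>i<7. \<Prod>j<8. \<chi> (a + \<zeta> ^ j) ^ (t i * pattern_exp i j))"
          using a by (simp add: v_eq prod_power_distrib mult.commute flip: power_mult)
        also have "\<dots> = (\<Prod>j<8. \<chi> (a + \<zeta> ^ j) ^ e j)"
          by (subst prod.swap) (simp add: e_def power_sum)
        also have "\<dots> = \<chi> (\<Prod>j<8. (a + \<zeta> ^ j) ^ e j)"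
          using X_add_nz[OF a] by (simp add: chi_prod chi_power)
        finally show ?thesis .
      qed
      hence "(\<Sum>a\<in>X. \<Prod>i\<in>{..<7}. v i a ^ t i) = (\<Sum>a\<in>X. \<chi> (\<Prod>j<8. (a + \<zeta> ^ j) ^ e j))"
        by (intro sum.cong refl)
      moreover have "(\<Sum>j<8. e j) = (\<Sum>i<7. t i * (\<Sum>j<8. pattern_exp i j))"
        unfolding e_def by (subst sum.swap) (simp add: sum_distrib_left)
      hence "(\<Sum>j<8. e j) = (\<Sum>i<7. t i * 8)" by (simp add: sum_pattern_exp)
      hence "8 dvd (\<Sum>j<8. e j)" by (simp add: dvd_sum)
      moreover have "\<not> (\<forall>j<8. 8 dvd e j)"
        using pattern_combination_eq_0[OF t(1)] t(2) unfolding e_def by (metis lessThan_iff)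
      ultimately show ?thesis using octic_character_sum_le[of e] r by simp
    qed
    have "(\<Prod>i\<in>{..<7}. pattern_ord i) = 131072"
      unfolding lessThan_7 by (simp add: pattern_ord_def)
    \<comment> \<open>The leading coefficient \<open>131072 * 50 = 6553600\<close> stays below the
      bound on \<open>r\<close>, with room for the constants.\<close>
    moreover have "131072 * (50 * real r + 9) < real (card X)"
    proof -
      define s where "s = real r * real r"
      have "10485731 * real r \<le> s" unfolding s_def using r by (intro mult_right_mono) auto
      moreover have "10485731 \<le> real r" using r by simp
      hence "131072 * (50 * real r + 9) + 9 < 10485731 * real r" by simp
      ultimately have "131072 * (50 * real r + 9) + 9 < s" by simp
      moreover have "real (card X) + 9 = s"
        using arg_cong[OF card_X, of real] by (simp add: s_def power2_eq_square)
      ultimately show ?thesis by linarith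
    qed
    ultimately show "real (\<Prod>i\<in>{..<7}. pattern_ord i) * (50 * real r + 9) < real (card X)" by simp
  qed auto
  then obtain a where "a \<in> X" "\<forall>i<7. v i a = 1" by auto
  moreover have "(\<Prod>j<8. (a + \<zeta> ^ j) ^ pattern_exp i j) \<noteq> 0" for i
    using X_add_nz[OF \<open>a \<in> X\<close>] by simp
  ultimately show ?thesis by (auto simp: v_def chi_eq_1_iff)
qed

text \<open>On the class \<open>x ^ g = \<zeta> ^ k\<close> the map is multiplication by
  \<open>a + \<zeta> ^ k\<close>, and the \<open>g\<close>-th power of its values there is
  \<open>\<zeta> ^ k * w k\<close>. So it is injective once these eight values differ, which the
  pattern ensures.\<close>

lemma exists_binomial_permutation:
  assumes r: "r \<ge> 10485731"
  shows "\<exists>a\<noteq>0. (\<lambda>c::'a. a * c ^ 1 + 1 * c ^ (g + 1)) \<in> binom_gens"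
proof -
  obtain a where a: "a \<in> X" and pat: "\<forall>i<7. (\<Prod>j<8. (a + \<zeta> ^ j) ^ pattern_exp i j) ^ g = 1"
    using exists_pattern[OF r] by blast
  have a_nz: "a \<noteq> 0" using a by (simp add: X_def)
  define w where "w j = (a + \<zeta> ^ j) ^ g" for j
  have w8: "w j ^ 8 = 1" for j
  proof -
    have "w j ^ 8 = (a + \<zeta> ^ j) ^ (8 * g)" by (simp only: w_def mult.commute[of 8] power_mult)
    thus ?thesis unfolding g power_q_minus_1[OF X_add_nz[OF a]] .
  qed
  have "(\<Prod>j<8. w j ^ pattern_exp i j) = 1" if "i < 7" for i
  proof -
    have "(\<Prod>j<8. w j ^ pattern_exp i j) = (\<Prod>j<8. (a + \<zeta> ^ j) ^ pattern_exp i j) ^ g"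
      by (simp add: w_def prod_power_distrib mult.commute flip: power_mult)
    thus ?thesis using pat that by simp
  qed
  hence "\<forall>i<7. (\<Prod>j<8. w j ^ pattern_exp i j) = 1" by blast
  hence w: "w 0 ^ 4 * w 1 ^ 4 = 1" "w 0 ^ 6 * w 2 ^ 2 = 1" "w 1 ^ 6 * w 3 ^ 2 = 1"
      "w 0 ^ 7 * w 4 = 1" "w 1 ^ 7 * w 5 = 1" "w 2 ^ 7 * w 6 = 1" "w 3 ^ 7 * w 7 = 1"
    unfolding all_less_7 lessThan_8 by (simp_all add: pattern_exp_def)
  \<comment> \<open>This undoes the reduction of negative exponents: \<open>8 - k\<close> stands for
    \<open>- k\<close>.\<close>
  have inv: "y = x ^ k" if "x ^ (8 - k) * y = 1" "x ^ 8 = 1" "k \<le> 8" for x y :: 'a and k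
  proof -
    have "x ^ k = x ^ k * (x ^ (8 - k) * y)" using that by simp
    also have "\<dots> = x ^ (k + (8 - k)) * y" by (simp only: power_add mult.assoc)
    finally show ?thesis using that by simp
  qed
  have w1: "w 1 ^ 4 = w 0 ^ 4" "w 2 ^ 2 = w 0 ^ 2" "w 3 ^ 2 = w 1 ^ 2"
      "w 4 = w 0" "w 5 = w 1" "w 6 = w 2" "w 7 = w 3"
    using inv[of "w 0" 4 "w 1 ^ 4"] inv[of "w 0" 2 "w 2 ^ 2"] inv[of "w 1" 2 "w 3 ^ 2"]
      inv[of "w 0" 1 "w 4"] inv[of "w 1" 1 "w 5"] inv[of "w 2" 1 "w 6"] inv[of "w 3" 1 "w 7"] w w8
    by simp_all
  have sq4: "x ^ 4 = (x ^ 2) ^ 2" for x :: 'a by (simp flip: power_mult)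
  have w_mod4: "\<forall>j<8. w j = w (j mod 4)"
    unfolding all_less_8 using w1 by simp
  have w_mod2: "\<forall>j<8. w j ^ 2 = w (j mod 2) ^ 2"
    unfolding all_less_8 using w1 by simp
  have w_4: "\<forall>j<8. w j ^ 4 = w 0 ^ 4"
  proof -
    have "w 2 ^ 4 = w 0 ^ 4" "w 3 ^ 4 = w 1 ^ 4" unfolding sq4 w1(2,3) by (rule refl)+
    thus ?thesis unfolding all_less_8 using w1 by simp
  qed
  have w_nz: "w j \<noteq> 0" for j using w8[of j] by auto
  have inj_w: "i = j" if ij: "i < 8" "j < 8" "\<zeta> ^ i * w i = \<zeta> ^ j * w j" for i j
  proof -
    \<comment> \<open>The fourth powers of the \<open>w j\<close> agree, so the parity of the index
      is recovered first. Squares then give it modulo \<open>4\<close>, and finally the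
      \<open>w j\<close> themselves cancel.\<close>
    have "(\<zeta> ^ i * w i) ^ 4 = (\<zeta> ^ j * w j) ^ 4" using ij by simp
    hence "\<zeta> ^ (i * 4) * w 0 ^ 4 = \<zeta> ^ (j * 4) * w 0 ^ 4"
      unfolding power_mult_distrib w_4[rule_format, OF ij(1)] w_4[rule_format, OF ij(2)]
        power_mult .
    hence "\<zeta> ^ (i * 4) = \<zeta> ^ (j * 4)" using w_nz by simp
    hence 2: "i mod 2 = j mod 2"
      using mult_mod_left[of i 2 4] mult_mod_left[of j 2 4] by (simp add: zeta_power_eq_iff)
    have "(\<zeta> ^ i * w i) ^ 2 = (\<zeta> ^ j * w j) ^ 2" using ij by simp
    hence "\<zeta> ^ (i * 2) * w (i mod 2) ^ 2 = \<zeta> ^ (j * 2) * w (j mod 2) ^ 2"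
      unfolding power_mult_distrib power_mult
        w_mod2[rule_format, OF ij(1), symmetric] w_mod2[rule_format, OF ij(2), symmetric] .
    hence "\<zeta> ^ (i * 2) = \<zeta> ^ (j * 2)" using w_nz 2 by simp
    hence "i mod 4 = j mod 4"
      using mult_mod_left[of i 4 2] mult_mod_left[of j 4 2] by (simp add: zeta_power_eq_iff)
    hence "w i = w j" using w_mod4 ij by metis
    hence "\<zeta> ^ i = \<zeta> ^ j" using ij(3) w_nz by simp
    thus ?thesis using ij by (simp add: zeta_power_eq_iff)
  qed
  let ?f = "\<lambda>c::'a. a * c ^ 1 + 1 * c ^ (g + 1)"
  have f: "?f x = x * (a + \<zeta> ^ k)" if "x ^ g = \<zeta> ^ k" for x k
    using that by (simp add: algebra_simps)
  have nz: "?f x \<noteq> 0" if "x \<noteq> 0" for x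
  proof -
    obtain k where k: "x ^ g = \<zeta> ^ k" using power_g \<open>x \<noteq> 0\<close> by blast
    show ?thesis unfolding f[OF k] using X_add_nz a that by simp
  qed
  have inj: "x = y" if xy: "x \<noteq> 0" "y \<noteq> 0" "?f x = ?f y" for x y
  proof -
    obtain k where k: "k < 8" "x ^ g = \<zeta> ^ k" using power_g \<open>x \<noteq> 0\<close> by blast
    obtain l where l: "l < 8" "y ^ g = \<zeta> ^ l" using power_g \<open>y \<noteq> 0\<close> by blast
    have eq: "x * (a + \<zeta> ^ k) = y * (a + \<zeta> ^ l)" using xy(3) unfolding f[OF k(2)] f[OF l(2)] .
    hence "(x * (a + \<zeta> ^ k)) ^ g = (y * (a + \<zeta> ^ l)) ^ g" by simp
    hence "\<zeta> ^ k * w k = \<zeta> ^ l * w l" by (simp add: power_mult_distrib k l w_def)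
    hence "k = l" using inj_w k l by blast
    with eq show ?thesis using X_add_nz[OF a] by simp
  qed
  have "inj_on ?f units_set" using inj by (auto simp: units_set_def inj_on_def simp del: power_Suc)
  moreover have "?f ` units_set \<subseteq> units_set" using nz by (auto simp: units_set_def simp del: power_Suc)
  ultimately have "bij_betw ?f units_set units_set"
    unfolding bij_betw_def by (metis endo_inj_surj finite)
  moreover have "0 < g" "g + 1 < card (UNIV :: 'a set)"
  proof -
    define s where "s = r\<^sup>2"
    have "10485731 * r \<le> s" unfolding s_def power2_eq_square using r by (intro mult_right_mono) auto
    thus "0 < g" "g + 1 < card (UNIV :: 'a set)"
      using g r unfolding card_field s_def[symmetric] by linarith+
  qed
  ultimately have "?f \<in> binom_gens"
    unfolding binom_gens_def using a_nz
    by (intro CollectI exI[of _ a] exI[of _ 1] exI[of _ "1::nat"] exI[of _ "g + 1"]) simp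
  thus ?thesis using a_nz by blast
qed

end

section \<open>Linear maps, the cubic binomial and blocks\<close>

context quadratic_field begin

lemma frobenius_diff: "(x - y :: 'a) ^ r = x ^ r - y ^ r"
  using frobenius_add[of "x - y" y] by simp

lemma frobenius_minus: "(- x :: 'a) ^ r = - (x ^ r)"
  using frobenius_diff[of 0 x] r_gt_1 by (simp add: power_0_left)

lemma frobenius_frobenius: "((x :: 'a) ^ r) ^ r = x"
  by (simp add: power_r_r flip: power_mult)

lemma frobenius_norm: "((x :: 'a) ^ (r + 1)) ^ r = x ^ (r + 1)"
  by (simp add: power_mult_distrib frobenius_frobenius mult.commute)

text \<open>On the pair of \<open>c\<close> and \<open>c ^ r\<close> this acts by the matrix with
  rows \<open>a, b\<close> and \<open>b ^ r, a ^ r\<close>, so its determinant is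
  \<open>a ^ (r + 1) - b ^ (r + 1)\<close>.\<close>

definition lin :: "'a \<Rightarrow> 'a \<Rightarrow> 'a \<Rightarrow> 'a" where
  "lin a b = (\<lambda>c. a * c + b * c ^ r)"

lemma lin_comp: "lin a b \<circ> lin c d = lin (a * c + b * d ^ r) (a * d + b * c ^ r)"
  by (auto simp: lin_def fun_eq_iff frobenius_add power_mult_distrib frobenius_frobenius algebra_simps)

lemma bij_betw_units:
  fixes f :: "'a \<Rightarrow> 'a"
  assumes "\<And>x. x \<noteq> 0 \<Longrightarrow> f x \<noteq> 0" "\<And>x y. x \<noteq> 0 \<Longrightarrow> y \<noteq> 0 \<Longrightarrow> f x = f y \<Longrightarrow> x = y"
  shows "bij_betw f units_set units_set"
proof -
  have "inj_on f units_set" using assms(2) by (intro inj_onI) (simp add: units_set_def)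
  moreover have "f ` units_set \<subseteq> units_set" using assms(1) by (auto simp: units_set_def)
  ultimately show ?thesis unfolding bij_betw_def by (metis endo_inj_surj finite)
qed

lemma r_plus_2_less: "r \<ge> 3 \<Longrightarrow> r + 2 < card (UNIV :: 'a set)"
proof -
  assume r: "r \<ge> 3"
  hence "r + 2 < 3 * r" by simp
  also have "\<dots> \<le> r * r" using r by (intro mult_right_mono) auto
  finally show ?thesis by (simp add: card_field power2_eq_square)
qed

text \<open>A nonzero kernel element satisfies \<open>a * x = - (b * x ^ r)\<close>. Multiplying
  this by its own \<open>r\<close>-th power would equate the norms of \<open>a\<close> and
  \<open>b\<close>.\<close>

lemma lin_in_binom_gens:
  assumes "a \<noteq> 0" "b \<noteq> 0" "a ^ (r + 1) \<noteq> b ^ (r + 1)" "r \<ge> 3"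
  shows "lin a b \<in> binom_gens"
proof -
  have diff: "lin a b (x - y) = lin a b x - lin a b y" for x y
    by (simp add: lin_def frobenius_diff algebra_simps)
  have ker: "x = 0" if "lin a b x = 0" for x
  proof (rule ccontr)
    assume "x \<noteq> 0"
    have "a * x = - (b * x ^ r)" using that by (simp add: lin_def eq_neg_iff_add_eq_0)
    moreover from this have "(a * x) ^ r = - (b ^ r * x)"
      by (simp add: frobenius_minus power_mult_distrib frobenius_frobenius)
    ultimately have "(a * x) * (a * x) ^ r = (b * x ^ r) * (b ^ r * x)" by simp
    hence "a ^ (r + 1) * x ^ (r + 1) = b ^ (r + 1) * x ^ (r + 1)"
      by (simp add: power_mult_distrib mult_ac)
    with assms \<open>x \<noteq> 0\<close> show False by simp
  qed
  have "bij_betw (lin a b) units_set units_set"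
    using ker diff by (intro bij_betw_units) (auto, metis diff_self eq_iff_diff_eq_0)
  thus ?thesis
    unfolding binom_gens_def using assms r_plus_2_less
    by (intro CollectI exI[of _ a] exI[of _ b] exI[of _ 1] exI[of _ r]) (auto simp: lin_def)
qed

text \<open>A map with \<open>a = 0\<close> or \<open>b = 0\<close> is no binomial. Composition with
  a suitable \<open>lin 1 u\<close> makes both coefficients nonzero, and the inverse of
  \<open>lin 1 u\<close> is again an admissible binomial that undoes this.\<close>

lemma lin_in_G:
  assumes ab: "a ^ (r + 1) \<noteq> b ^ (r + 1)" and r: "r \<ge> 3"
  shows "lin a b \<in> G_q"
proof (cases "a \<noteq> 0 \<and> b \<noteq> 0")
  case True
  thus ?thesis using lin_in_binom_gens ab r by (intro G_gen) auto
next
  case False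
  have "r + 1 < r\<^sup>2 - 1" using r_plus_2_less[OF r] by (simp add: card_field)
  then obtain u :: 'a where u: "u \<noteq> 0" "u ^ (r + 1) \<noteq> 1"
    using exists_power_neq_1[of "r + 1"] by auto
  \<comment> \<open>The determinant of \<open>lin 1 u\<close>. It lies in the subfield of order
    \<open>r\<close>, so the inverse is \<open>lin 1 (- u)\<close> divided by it.\<close>
  define D where "D = 1 - u ^ (r + 1)"
  have D: "D \<noteq> 0" "D ^ r = D"
    using u by (simp_all only: D_def frobenius_diff frobenius_norm power_one) auto
  have "(-u / D) ^ (r + 1) = u ^ (r + 1) / D ^ (r + 1)"
    by (simp add: power_divide frobenius_minus)
  hence "(1 / D) ^ (r + 1) \<noteq> (-u / D) ^ (r + 1)"
    using u D by (simp add: power_divide)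
  hence M': "lin (1 / D) (-u / D) \<in> G_q"
    using u D r by (intro G_gen lin_in_binom_gens) auto
  have "lin 1 u \<circ> lin (1 / D) (-u / D) = lin 1 0"
  proof -
    have "1 * (1 / D) + u * (-u / D) ^ r = 1"
      using D by (simp add: power_divide frobenius_minus field_simps) (simp add: D_def)
    moreover have "1 * (-u / D) + u * (1 / D) ^ r = 0"
      using D by (simp add: power_divide)
    ultimately show ?thesis by (simp only: lin_comp)
  qed
  hence "lin a b = (lin a b \<circ> lin 1 u) \<circ> lin (1 / D) (-u / D)"
    by (simp add: comp_assoc) (simp add: lin_def fun_eq_iff)
  moreover have "lin a b \<circ> lin 1 u \<in> G_q"
  proof -
    from False consider "b = 0" "a \<noteq> 0" | "a = 0" "b \<noteq> 0" using ab by auto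
    thus ?thesis
    proof cases
      case 1
      have "(a * u) ^ (r + 1) = a ^ (r + 1) * u ^ (r + 1)" by (rule power_mult_distrib)
      hence "a ^ (r + 1) \<noteq> (a * u) ^ (r + 1)" using 1 u by simp
      hence "lin a (a * u) \<in> G_q" using 1 u r by (intro G_gen lin_in_binom_gens) auto
      thus ?thesis using 1 by (simp add: lin_comp)
    next
      case 2
      have "(b * u ^ r) ^ (r + 1) = b ^ (r + 1) * u ^ (r + 1)"
        by (simp add: power_mult_distrib frobenius_frobenius mult_ac)
      hence "(b * u ^ r) ^ (r + 1) \<noteq> b ^ (r + 1)" using 2 u by (simp add: mult.commute)
      hence "lin (b * u ^ r) b \<in> G_q" using 2 u r by (intro G_gen lin_in_binom_gens) auto
      thus ?thesis using 2 by (simp add: lin_comp)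
    qed
  qed
  ultimately show ?thesis using G_comp M' by metis
qed

text \<open>As \<open>r - 1\<close> is prime to \<open>3\<close>, the Frobenius map interchanges the
  primitive cube roots of unity, and cubing is injective on the subfield of order
  \<open>r\<close>.\<close>

lemma power_r_mod_3:
  assumes "r mod 3 = 2"
  shows "x ^ 3 = 1 \<Longrightarrow> (x::'a) ^ r = x ^ 2"
    and "u ^ r = u \<Longrightarrow> v ^ r = v \<Longrightarrow> u ^ 3 = v ^ 3 \<Longrightarrow> (u::'a) = v"
proof -
  obtain k where k: "r = 3 * k + 2"
    using assms by (metis mult_div_mod_eq)
  show "x ^ r = x ^ 2" if "x ^ 3 = 1" for x :: 'a
    using that by (simp add: k power_add power_mult power2_eq_square)
  \<comment> \<open>The exponent \<open>2 * k + 1\<close> inverts cubing, since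
    \<open>3 * (2 * k + 1) = 2 * (r - 1) + 1\<close>.\<close>
  have cube: "y = (y ^ 3) ^ (2 * k + 1)" if "y ^ r = y" for y :: 'a
  proof (cases "y = 0")
    case False
    have "y * (y ^ 3) ^ (2 * k + 1) = y ^ (1 + 3 * (2 * k + 1))"
      by (simp only: power_add power_mult power_one_right)
    also have "1 + 3 * (2 * k + 1) = r * 2" by (simp add: k)
    also have "y ^ (r * 2) = y * y" by (simp add: power_mult that power2_eq_square)
    finally show ?thesis using False by simp
  qed (simp add: k)
  show "u = v" if "u ^ r = u" "v ^ r = v" "u ^ 3 = v ^ 3" for u v :: 'a
    using cube[OF that(1)] cube[OF that(2)] that(3) by metis
qed

text \<open>
  With \<open>w\<close> a primitive cube root of unity and \<open>N x = x\<^bsup>r+1\<^esup>\<close>, the map \<open>f x = x (N x + 1 - w)\<close>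
  satisfies \<open>N (f x) = (N x + 1)\<^sup>3 - 1\<close>, and cubing permutes the subfield of order \<open>r\<close>.
\<close>
lemma cubic_in_binom_gens:
  assumes r: "r mod 3 = 2" "r \<ge> 3" and w: "w ^ 3 = 1" "(w::'a) \<noteq> 1"
  shows "(\<lambda>c. (1 - w) * c ^ 1 + 1 * c ^ (r + 2)) \<in> binom_gens"
proof -
  have w0: "w \<noteq> 0" using w(1) by auto
  have wr: "w ^ r = w ^ 2" using power_r_mod_3(1) r w by blast
  have "(w - 1) * (w ^ 2 + w + 1) = w ^ 3 - 1"
    by (simp add: algebra_simps power2_eq_square power3_eq_cube)
  hence "(w - 1) * (w ^ 2 + w + 1) = 0" using w(1) by simp
  hence "w ^ 2 + w + 1 = 0" using w(2) by simp
  hence "w ^ 2 + w + 1 - w - 1 = - w - 1" by simp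
  hence ww: "w ^ 2 = - w - 1" by simp
  let ?f = "\<lambda>c. (1 - w) * c ^ 1 + 1 * c ^ (r + 2)"
  define N where "N x = x ^ (r + 1)" for x :: 'a
  have N: "N x ^ r = N x" for x unfolding N_def by (rule frobenius_norm)
  have f: "?f x = x * (N x + 1 - w)" for x by (simp add: N_def algebra_simps)
  \<comment> \<open>\<open>N x\<close> is fixed by the Frobenius map, whereas \<open>w - 1\<close>
    is not.\<close>
  have nz1: "N x + 1 - w \<noteq> 0" for x
  proof
    assume "N x + 1 - w = 0"
    hence "N x = w - 1" by (simp add: algebra_simps)
    hence "w ^ 2 - 1 = w - 1" using N[of x] by (simp add: frobenius_diff wr)
    hence "w * (w - 1) = 0" by (simp add: algebra_simps power2_eq_square)
    thus False using w w0 by simp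
  qed
  have norm: "N (x * (N x + 1 - w)) = (N x + 1) ^ 3 - 1" for x
  proof -
    have "N (x * (N x + 1 - w)) = N x * ((N x + 1 - w) ^ r * (N x + 1 - w))"
      by (simp add: N_def power_mult_distrib mult_ac)
    also have "(N x + 1 - w) ^ r = N x + 1 + w + 1"
      by (simp add: frobenius_diff frobenius_add N wr ww)
    also have "N x * ((N x + 1 + w + 1) * (N x + 1 - w)) = N x * ((N x + 1) ^ 2 + (N x + 1) - w ^ 2 - w)"
      by (simp add: algebra_simps power2_eq_square)
    also have "\<dots> = (N x + 1) ^ 3 - 1"
      unfolding ww by (simp add: algebra_simps power2_eq_square power3_eq_cube)
    finally show ?thesis .
  qed
  have "bij_betw ?f units_set units_set"
  proof (rule bij_betw_units)
    show "?f x \<noteq> 0" if "x \<noteq> 0" for x unfolding f using that nz1 by simp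
    fix x y assume "?f x = ?f y"
    hence eq: "x * (N x + 1 - w) = y * (N y + 1 - w)" unfolding f .
    hence "(N x + 1) ^ 3 = (N y + 1) ^ 3" using norm[of x] norm[of y] by simp
    moreover have "(N z + 1) ^ r = N z + 1" for z by (simp add: frobenius_add N)
    ultimately have "N x + 1 = N y + 1" using power_r_mod_3(2)[OF r(1)] by blast
    with eq show "x = y" using nz1[of y] by simp
  qed
  moreover have "r + 2 < card (UNIV :: 'a set)" using r_plus_2_less r by simp
  ultimately show ?thesis
    unfolding binom_gens_def using w
    by (intro CollectI exI[of _ "1 - w"] exI[of _ 1] exI[of _ "1::nat"] exI[of _ "r + 2"]) auto
qed

text \<open>If \<open>S\<close> contains some \<open>y\<close> outside the subfield of order
  \<open>r\<close>, then \<open>1\<close> and \<open>y\<close> form a basis over it, and linear maps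
  fixing \<open>1\<close> carry \<open>y\<close> to any other element outside. Otherwise the cubic
  binomial leaves only \<open>1\<close> and \<open>-1\<close>, and the binomial with odd
  \<open>g\<close> excludes \<open>-1\<close>.\<close>

lemma block_of_1_trivial:
  fixes S :: "'a set"
  assumes r: "r mod 3 = 2" "r \<ge> 3" and w: "w ^ 3 = 1" "(w::'a) \<noteq> 1"
    and b: "(\<lambda>c::'a. a * c ^ 1 + 1 * c ^ (g + 1)) \<in> binom_gens" "a \<noteq> 0" "odd g"
    and two: "(-1 :: 'a) \<noteq> 1"
    and S: "1 \<in> S" "0 \<notin> S"
    and quot: "\<And>h x y. h \<in> G_q \<Longrightarrow> x \<in> S \<Longrightarrow> y \<in> S \<Longrightarrow> h x / h y \<in> S"
  shows "S = {1} \<or> S = units_set"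
proof (cases "\<exists>y\<in>S. y ^ r \<noteq> y")
  case True
  then obtain y where y: "y \<in> S" "y ^ r \<noteq> y" by blast
  have y0: "y \<noteq> 0" using y S by auto
  have out: "z \<in> S" if z: "z ^ r \<noteq> z" for z
  proof -
    \<comment> \<open>This coefficient makes \<open>lin (1 - b) b\<close> fix \<open>1\<close> and
      send \<open>y\<close> to \<open>z\<close>.\<close>
    define b where "b = (z - y) / (y ^ r - y)"
    have nz: "y ^ r - y \<noteq> 0" using y by simp
    have beq: "b * (y ^ r - y) = z - y" using nz by (simp add: b_def)
    have breq: "b ^ r * (y ^ r - y) = y ^ r - z ^ r"
      using arg_cong[OF beq, of "\<lambda>t. t ^ r"]
      by (simp add: power_mult_distrib frobenius_diff frobenius_frobenius algebra_simps)
    \<comment> \<open>The determinant turns out to be \<open>(z ^ r - z) / (y ^ r - y)\<close>,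
      nonzero because \<open>z\<close> is outside the subfield.\<close>
    have "((1 - b) ^ (r + 1) - b ^ (r + 1)) * (y ^ r - y)
        = (y ^ r - y) - b * (y ^ r - y) - b ^ r * (y ^ r - y)"
      by (simp add: frobenius_diff algebra_simps)
    also have "\<dots> = z ^ r - z" unfolding beq breq by (simp add: algebra_simps)
    finally have "(1 - b) ^ (r + 1) \<noteq> b ^ (r + 1)" using z by auto
    hence "lin (1 - b) b \<in> G_q" using r by (intro lin_in_G) auto
    from quot[OF this y(1) S(1)] have "lin (1 - b) b y / lin (1 - b) b 1 \<in> S" .
    moreover have "lin (1 - b) b 1 = 1" by (simp add: lin_def)
    moreover have "lin (1 - b) b y = z" using beq by (simp add: lin_def algebra_simps)
    ultimately show ?thesis by simp
  qed
  have "z \<in> S" if "z \<noteq> 0" for z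
  proof (cases "z ^ r = z")
    case True
    \<comment> \<open>Nonzero elements of the subfield are reached as quotients of two elements
      outside it.\<close>
    have "z * y \<in> S" using True y that by (intro out) (simp add: power_mult_distrib)
    from quot[OF G_id this y(1)] show ?thesis using y0 by simp
  qed (rule out)
  thus ?thesis using S by (auto simp: units_set_def)
next
  case False
  hence fix_r: "\<And>y. y \<in> S \<Longrightarrow> y ^ r = y" by blast
  have pm: "\<eta> = 1 \<or> \<eta> = -1" if eta: "\<eta> \<in> S" for \<eta>
  proof -
    define \<beta> where "\<beta> = 1 - w"
    define f where "f = (\<lambda>c. (1 - w) * c ^ 1 + 1 * c ^ (r + 2))"
    define s where "s = f \<eta> / f 1"
    have f_gen: "f \<in> binom_gens" unfolding f_def using cubic_in_binom_gens r w by blast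
    hence "bij_betw f units_set units_set" by (auto simp: binom_gens_def)
    hence f1: "f 1 \<noteq> 0" by (auto simp: bij_betw_def units_set_def)
    have "s \<in> S" unfolding s_def using quot[OF G_gen[OF f_gen] eta S(1)] .
    hence sr: "s ^ r = s" by (rule fix_r)
    have er: "\<eta> ^ r = \<eta>" using fix_r eta .
    have eta0: "\<eta> \<noteq> 0" using eta S by auto
    have "f \<eta> = \<eta> * (\<eta> ^ 2 + \<beta>)"
      by (simp add: f_def \<beta>_def er power2_eq_square algebra_simps)
    moreover have "f 1 = 1 + \<beta>" by (simp add: f_def \<beta>_def)
    ultimately have 1: "s * (1 + \<beta>) = \<eta> * (\<eta> ^ 2 + \<beta>)" using f1 by (simp add: s_def)
    have "(s * (1 + \<beta>)) ^ r = s * (1 + \<beta> ^ r)"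
      by (simp add: power_mult_distrib frobenius_add sr)
    moreover have "(\<eta> * (\<eta> ^ 2 + \<beta>)) ^ r = \<eta> * (\<eta> ^ 2 + \<beta> ^ r)"
      by (simp add: power_mult_distrib frobenius_add er power2_eq_square)
    ultimately have 2: "s * (1 + \<beta> ^ r) = \<eta> * (\<eta> ^ 2 + \<beta> ^ r)" using 1 by metis
    \<comment> \<open>Subtracting the conjugate equation isolates the coefficient of
      \<open>\<beta>\<close>. As \<open>\<beta>\<close> is outside the subfield,
      \<open>s = \<eta>\<close>, and the first equation then gives
      \<open>\<eta> ^ 2 = 1\<close>.\<close>
    have "(s - \<eta>) * (\<beta> - \<beta> ^ r)
        = s * (1 + \<beta>) - s * (1 + \<beta> ^ r) - (\<eta> * (\<eta> ^ 2 + \<beta>) - \<eta> * (\<eta> ^ 2 + \<beta> ^ r))"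
      by (simp add: algebra_simps)
    hence "(s - \<eta>) * (\<beta> - \<beta> ^ r) = 0" unfolding 1 2 by simp
    moreover have "\<beta> - \<beta> ^ r \<noteq> 0"
    proof
      assume "\<beta> - \<beta> ^ r = 0"
      hence "w * (w - 1) = 0"
        using power_r_mod_3(1)[OF r(1) w(1)]
        by (simp add: \<beta>_def frobenius_diff algebra_simps power2_eq_square)
      thus False using w by auto
    qed
    ultimately have "s = \<eta>" by simp
    with 1 eta0 have "\<eta> ^ 2 = 1" by simp
    thus ?thesis by (simp add: power2_eq_1_iff)
  qed
  have "-1 \<notin> S"
  proof
    assume m1: "-1 \<in> S"
    define f where "f = (\<lambda>c::'a. a * c ^ 1 + 1 * c ^ (g + 1))"
    have f_gen: "f \<in> binom_gens" using b unfolding f_def by blast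
    hence "bij_betw f units_set units_set" by (auto simp: binom_gens_def)
    hence f1: "f 1 \<noteq> 0" by (auto simp: bij_betw_def units_set_def)
    have "f (-1) / f 1 = 1 \<or> f (-1) / f 1 = -1"
      using pm quot[OF G_gen[OF f_gen] m1 S(1)] by blast
    hence "f (-1) = f 1 \<or> f (-1) = - f 1" using f1 by (auto simp: field_simps)
    \<comment> \<open>Since \<open>g + 1\<close> is even, the sign change affects only the linear
      term.\<close>
    moreover have "f (-1) = 1 - a" "f 1 = 1 + a" using b by (simp_all add: f_def)
    ultimately have "a + a = 0 \<or> (1::'a) + 1 = 0" by (auto simp: algebra_simps)
    moreover have "(1::'a) + 1 \<noteq> 0" using two by (metis eq_neg_iff_add_eq_0)
    moreover have "a + a = a * (1 + 1)" by (simp add: algebra_simps)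
    ultimately show False using b(2) by simp
  qed
  with pm S(1) show ?thesis by auto
qed

end

text \<open>Multiplications belong to \<open>H\<close>, so every block is a multiple of the block
  \<open>S\<close> of \<open>1\<close>. In particular \<open>h\<close> maps \<open>S\<close> onto
  \<open>h y\<close> times \<open>S\<close> for each \<open>y \<in> S\<close>, and invariance
  becomes a closure condition on quotients.\<close>

lemma primitive_on_units_setI:
  fixes H :: "('a::{finite,field} \<Rightarrow> 'a) set"
  assumes mult: "\<And>c. c \<noteq> 0 \<Longrightarrow> (\<lambda>x. c * x) \<in> H"
    and H0: "\<And>h x. h \<in> H \<Longrightarrow> x \<noteq> 0 \<Longrightarrow> h x \<noteq> 0"
    and triv: "\<And>S. 1 \<in> S \<Longrightarrow> 0 \<notin> S \<Longrightarrow> (\<And>h x y. h \<in> H \<Longrightarrow> x \<in> S \<Longrightarrow> y \<in> S \<Longrightarrow> h x / h y \<in> S)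
                  \<Longrightarrow> S = {1} \<or> S = units_set"
  shows "primitive_on units_set H"
  unfolding primitive_on_def
proof (intro allI impI)
  fix P :: "'a set set"
  assume P: "partition_on units_set P \<and> (\<forall>h\<in>H. \<forall>S\<in>P. h ` S \<in> P)"
  hence inv: "\<And>h S. h \<in> H \<Longrightarrow> S \<in> P \<Longrightarrow> h ` S \<in> P" by blast
  have un: "\<Union> P = units_set" and ne: "{} \<notin> P" and dis: "disjoint P"
    using P by (auto simp: partition_on_def)
  have same: "S = T" if "S \<in> P" "T \<in> P" "x \<in> S" "x \<in> T" for S T x
    using dis that by (auto simp: disjoint_def)
  have "1 \<in> \<Union> P" by (simp add: un units_set_def)
  then obtain S where S: "S \<in> P" "1 \<in> S" by blast
  have S0: "x \<noteq> 0" if "x \<in> T" "T \<in> P" for x T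
    using that un by (auto simp: units_set_def)
  have coset: "T = (\<lambda>x. c * x) ` S" if T: "T \<in> P" "c \<in> T" for T c
  proof (rule same[OF T(1) _ T(2)])
    show "(\<lambda>x. c * x) ` S \<in> P" using mult inv S S0 T by blast
    show "c \<in> (\<lambda>x. c * x) ` S" using S by force
  qed
  have "S = {1} \<or> S = units_set"
  proof (rule triv[OF S(2)])
    show "0 \<notin> S" using S0 S by blast
    fix h x y assume h: "h \<in> H" and xy: "x \<in> S" "y \<in> S"
    have "h ` S = (\<lambda>x. h y * x) ` S" using coset inv h S xy by blast
    then obtain t where "t \<in> S" "h x = h y * t" using xy by blast
    moreover have "h y \<noteq> 0" using H0 h S0 xy S by blast
    ultimately show "h x / h y \<in> S" by simp
  qed
  thus "P = {units_set} \<or> P = {{x} |x. x \<in> units_set}"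
  proof
    assume eq: "S = units_set"
    have "T = S" if "T \<in> P" for T
    proof -
      obtain c where "c \<in> T" using ne \<open>T \<in> P\<close> by (metis all_not_in_conv)
      moreover from this have "c \<in> S" using un that eq by blast
      ultimately show ?thesis using same that S by blast
    qed
    with S eq show ?thesis by blast
  next
    assume eq: "S = {1}"
    have sing: "T = {c}" if "T \<in> P" "c \<in> T" for T c using coset[OF that] eq by simp
    have "P = {{x} |x. x \<in> units_set}"
    proof (intro equalityI subsetI)
      fix T assume "T \<in> P"
      moreover obtain c where "c \<in> T" using ne \<open>T \<in> P\<close> by (metis all_not_in_conv)
      ultimately show "T \<in> {{x} |x. x \<in> units_set}" using sing un by blast
    next
      fix T :: "'a set" assume "T \<in> {{x} |x. x \<in> units_set}"
      then obtain x where x: "T = {x}" "x \<in> units_set" by blast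
      then obtain U where "U \<in> P" "x \<in> U" using un by blast
      with sing x show "T \<in> P" by metis
    qed
    thus ?thesis by blast
  qed
qed

text \<open>The generators are given as bijections of the units, while \<open>inv\<close> in
  \<open>G_q\<close> refers to the whole field. Carrying \<open>f 0 = 0\<close> through the
  induction reconciles the two.\<close>

lemma G_q_bij: "(f :: 'a::{finite,field} \<Rightarrow> 'a) \<in> G_q \<Longrightarrow> bij f \<and> f 0 = 0"
proof (induction rule: G_q.induct)
  case G_id
  show ?case by (metis bij_id id_apply)
next
  case (G_gen f)
  then obtain a b m n where f: "f = (\<lambda>c. a * c ^ m + b * c ^ n)" "0 < m" "m < n"
    and bij: "bij_betw f units_set units_set"
    by (auto simp: binom_gens_def)
  have f0: "f 0 = 0" using f by (simp add: power_0_left)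
  have "bij_betw f (insert 0 units_set) (insert (f 0) units_set)"
    using bij f0 by (subst notIn_Un_bij_betw3[of 0 units_set f units_set, simplified, symmetric])
      (auto simp: units_set_def)
  moreover have "insert 0 units_set = (UNIV :: 'a set)" by (auto simp: units_set_def)
  ultimately show ?case using f0 by metis
next
  case (G_comp f g)
  thus ?case by (metis bij_comp comp_apply)
next
  case (G_inv f)
  thus ?case by (auto simp: bij_imp_bij_inv bij_is_inj intro!: inv_f_eq)
qed

theorem theorem4p7:
  fixes r :: nat
  assumes "primepow r"
    and "r \<ge> 10485731"
    and "r mod 3 = 2"
    and "r mod 8 = 3 \<or> r mod 8 = 5"
    and "card (UNIV :: 'a::{finite,field} set) = r ^ 2"
  shows "primitive_on (units_set :: 'a set) G_q"
proof -
  interpret quadratic_field r "TYPE('a)"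
    using assms by unfold_locales
  have r3: "r \<ge> 3" using assms by simp
  have rr: "10485731 * 10485731 \<le> r\<^sup>2"
    unfolding power2_eq_square by (rule mult_le_mono[OF assms(2) assms(2)])
  have two: "(-1 :: 'a) \<noteq> 1"
  proof
    assume "(-1 :: 'a) = 1"
    hence "of_nat 2 = (0 :: 'a)" by (simp add: eq_neg_iff_add_eq_0)
    hence "CHAR('a) dvd 2" using of_nat_eq_0_iff_char_dvd by blast
    hence "CHAR('a) = 2" using r_eq_CHAR_power(1) by (simp add: primes_dvd_imp_eq)
    then obtain k where k: "r = 2 ^ k" using r_eq_CHAR_power(2) by auto
    hence "even r" using assms(2) by (cases k) auto
    thus False using assms(4) by presburger
  qed
  define g where "g = (r\<^sup>2 - 1) div 8"
  \<comment> \<open>With \<open>r\<close> equal to \<open>3\<close> or \<open>5\<close> modulo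
    \<open>8\<close>, the square is \<open>9\<close> modulo \<open>16\<close>, which makes
    \<open>g\<close> odd.\<close>
  have "\<exists>t. r\<^sup>2 = 16 * t + 9"
  proof -
    obtain k where "r = 8 * k + 3 \<or> r = 8 * k + 5" using assms(4) by (metis mult_div_mod_eq)
    thus ?thesis
    proof
      assume "r = 8 * k + 3"
      hence "r\<^sup>2 = 16 * (4 * k\<^sup>2 + 3 * k) + 9" by (simp add: power2_eq_square algebra_simps)
      thus ?thesis by blast
    next
      assume "r = 8 * k + 5"
      hence "r\<^sup>2 = 16 * (4 * k\<^sup>2 + 5 * k + 1) + 9" by (simp add: power2_eq_square algebra_simps)
      thus ?thesis by blast
    qed
  qed
  then obtain t where t: "r\<^sup>2 = 16 * t + 9" by blast
  have g: "8 * g = r\<^sup>2 - 1" and odd_g: "odd g" by (simp_all add: g_def t)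
  have "0 < 4 * g" "4 * g < r\<^sup>2 - 1" using g rr by linarith+
  \<comment> \<open>The value \<open>u ^ (4 * g)\<close> is a square root of \<open>1\<close> other
    than \<open>1\<close>, so \<open>u ^ g\<close> is a primitive eighth root of unity.\<close>
  then obtain u :: 'a where u: "u \<noteq> 0" "u ^ (4 * g) \<noteq> 1"
    using exists_power_neq_1[of "4 * g"] by blast
  have "(u ^ (4 * g)) ^ 2 = u ^ (8 * g)" by (simp add: mult.commute flip: power_mult)
  also have "\<dots> = 1" unfolding g by (rule power_q_minus_1[OF u(1)])
  finally have "u ^ (4 * g) = -1" using u(2) unfolding power2_eq_1_iff by blast
  hence "(u ^ g) ^ 4 = -1" by (simp add: mult.commute flip: power_mult)
  then interpret octic_field r "TYPE('a)" "u ^ g" g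
    using two g by unfold_locales
  obtain a :: 'a where a: "a \<noteq> 0" "(\<lambda>c. a * c ^ 1 + 1 * c ^ (g + 1)) \<in> binom_gens"
    using exists_binomial_permutation assms(2) by blast
  \<comment> \<open>For \<open>m\<close> a third of \<open>r\<^sup>2 - 1\<close>, a unit
    \<open>y\<close> with \<open>y ^ m \<noteq> 1\<close> yields the primitive cube root of unity
    \<open>y ^ m\<close>.\<close>
  have "\<exists>m. r\<^sup>2 = 3 * m + 1"
  proof -
    obtain k where "r = 3 * k + 2" using assms(3) by (metis mult_div_mod_eq)
    hence "r\<^sup>2 = 3 * (3 * k\<^sup>2 + 4 * k + 1) + 1" by (simp add: power2_eq_square algebra_simps)
    thus ?thesis by blast
  qed
  then obtain m where m: "r\<^sup>2 = 3 * m + 1" by blast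
  hence "0 < m" "m < r\<^sup>2 - 1" using rr by linarith+
  then obtain y :: 'a where y: "y \<noteq> 0" "y ^ m \<noteq> 1"
    using exists_power_neq_1[of m] by blast
  have w: "(y ^ m) ^ 3 = 1"
    using power_q_minus_1[OF y(1)] by (simp add: m mult.commute flip: power_mult)
  show ?thesis
  proof (rule primitive_on_units_setI)
    show "(\<lambda>x. c * x) \<in> G_q" if "c \<noteq> 0" for c :: 'a
    proof -
      have "lin c 0 \<in> G_q" using that r3 by (intro lin_in_G) auto
      thus ?thesis by (simp add: lin_def)
    qed
    show "h x \<noteq> 0" if "h \<in> G_q" "x \<noteq> 0" for h and x :: 'a
      using G_q_bij[OF that(1)] that(2) by (metis bij_pointE)
  qed (use block_of_1_trivial[OF assms(3) r3 w y(2) a(2,1) odd_g two] in blast)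
qed

end
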